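(* Let $0<p<1$, $q=1-p$, $\sigma=\sqrt{pq}$, let $M$ and $n$ be nonnegative integers and let $A$ be a positive real number ($p,M,n,A$ are fixed). For a positive integer $N$ and real $x$ put $\hat{x}=Np+(2Npq)^{1/2}x$. Then, as $N\to\infty$, the following asymptotic expansion holds uniformly in real $x$ with $|x|\le A$: \[ \rho(\hat{x})\,k_n^{(p)}(\hat{x})=\frac{e^{-x^2}}{\sqrt{2\pi N}\,\sigma}\,\frac{(-q)^n}{n!}\sum_{k=0}^{M}\binom{n}{k}\,n^{\underline{k}}\,(\hat{x}+n-k)^{\underline{(n-k)}}\,\psi_{n-k}^{M}(x)+O\big(N^{\frac{n-M-2}{2}}\big), \] where terms with $k>n$ are understood to be zero.
   Context: Falling factorial: $y^{\underline{k}}=y(y-1)\cdots(y-k+1)$, $y^{\underline{0}}=1$. Weight function: $\rho(y)=\dfrac{N!\,p^{y}q^{N-y}}{\Gamma(1+y)\Gamma(N+1-y)}$, considered for real $y\in[0,N]$ (it depends on $N$ and $p$). Krawtchouk polynomials: for an integer $0\le n\le N$, \[ k_n^{(p)}(y)=k_n^{(p)}(y,N)=(-p)^n\binom{N}{n}K_n(y,p,N),\qquad K_n(y,p,N)={}_2F_1\Big(-y,-n;-N;\tfrac1p\Big)=\sum_{j=0}^{n}\frac{(-y)_j(-n)_j}{(-N)_j\,j!}\,p^{-j}, \] where $(a)_j=a(a+1)\cdots(a+j-1)$; this is a polynomial in $y$ and is evaluated at real $y$. Hermite polynomials: $H_m(x)=(-1)^m e^{x^2}\frac{d^m}{dx^m}e^{-x^2}$.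 Step: $h=\dfrac{1}{\sqrt{2Npq}}$. Coefficients $a_{s,j}$ ($s,j\ge 0$ integers): defined by $(e^{z}-1)^s=\sum_{j\ge 0}a_{s,j}z^{s+j}$; for example $a_{s,0}=1$, $a_{s,1}=\frac{s}{2}$, $a_{s,2}=\frac{s(3s+1)}{24}$. Let $\gamma_i$ be the $i$-th cumulant of the Bernoulli distribution with success probability $p$ (value $1$ with probability $p$, value $0$ with probability $q$). For an integer $\nu\ge 0$ and an integer $r\ge 0$ put \[ \tilde{q}_\nu(x)=\sum \frac{1}{2^{\nu/2+s}}\,H_{\nu+2s}(x)\prod_{m=1}^{\nu}\frac{1}{k_m!}\Big(\frac{\gamma_{m+2}}{(m+2)!\,\sigma^{m+2}}\Big)^{k_m},\qquad \tilde{g}_{\nu,r}(x)=e^{x^2}\frac{d^r}{dx^r}\Big(e^{-x^2}\tilde{q}_\nu(x)\Big), \] where the sum is over all nonnegative integer solutions $(k_1,\dots,k_\nu)$ of $k_1+2k_2+\dots+\nu k_\nu=\nu$, and $s=k_1+k_2+\dots+k_\nu$ for each such solution (so $\tilde{q}_0\equiv 1$). For integers $s\ge 0$ and $K\ge 0$ put \[ \psi_s^{K}(x)=\sum_{i=0}^{K}a_{s,i}\sum_{\nu=0}^{K-i}\frac{\tilde{g}_{\nu,s+i}(x)}{N^{\nu/2}}\,h^{s+i}. \] *)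

theory Defs
  imports "HOL-Probability.Probability" "HOL-Computational_Algebra.Formal_Power_Series"
begin

definition ffact :: "real \<Rightarrow> nat \<Rightarrow> real" where
  "ffact y k = (\<Prod>i<k. y - real i)"

text \<open>The binomial weight continued to real arguments; it is only meaningful for
  \<open>0 < p < 1\<close> and \<open>0 \<le> y \<le> N\<close>.\<close>

definition weight :: "real \<Rightarrow> nat \<Rightarrow> real \<Rightarrow> real" where
  "weight p N y =
     fact N * p powr y * (1 - p) powr (real N - y) / (Gamma (1 + y) * Gamma (real N + 1 - y))"

text \<open>The terminating series for \<open>2F1(-y, -n; -N; 1/p)\<close>, cut off at \<open>j = n\<close>.  It is only
  meaningful for \<open>n \<le> N\<close>; otherwise a factor \<open>pochhammer (- N) j\<close> in a denominator vanishes.\<close>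

definition krawtchouk_K :: "nat \<Rightarrow> real \<Rightarrow> real \<Rightarrow> nat \<Rightarrow> real" where
  "krawtchouk_K n y p N =
     (\<Sum>j\<le>n. pochhammer (- y) j * pochhammer (- real n) j /
             (pochhammer (- real N) j * fact j) * (1 / p) ^ j)"

definition krawtchouk :: "real \<Rightarrow> nat \<Rightarrow> nat \<Rightarrow> real \<Rightarrow> real" where
  "krawtchouk p N n y = (- p) ^ n * real (N choose n) * krawtchouk_K n y p N"

definition hermite :: "nat \<Rightarrow> real \<Rightarrow> real" where
  "hermite m x = (- 1) ^ m * exp (x\<^sup>2) * (deriv ^^ m) (\<lambda>t. exp (- (t\<^sup>2))) x"

definition step :: "real \<Rightarrow> nat \<Rightarrow> real" where
  "step p N = 1 / sqrt (2 * real N * p * (1 - p))"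

definition xhat :: "real \<Rightarrow> nat \<Rightarrow> real \<Rightarrow> real" where
  "xhat p N x = real N * p + sqrt (2 * real N * p * (1 - p)) * x"

definition exp_coeff :: "nat \<Rightarrow> nat \<Rightarrow> real" where
  "exp_coeff s j = fps_nth ((fps_exp 1 - 1) ^ s) (s + j)"

text \<open>The \<open>i\<close>-th cumulant of a real random variable with law \<open>X\<close>: the \<open>i\<close>-th derivative at
  \<open>0\<close> of the logarithm of the moment generating function.\<close>

definition cumulant :: "real pmf \<Rightarrow> nat \<Rightarrow> real" where
  "cumulant X i = (deriv ^^ i) (\<lambda>t. ln (measure_pmf.expectation X (\<lambda>x. exp (t * x)))) 0"

definition bernoulli_cumulant :: "real \<Rightarrow> nat \<Rightarrow> real" where
  "bernoulli_cumulant p i = cumulant (map_pmf of_bool (bernoulli_pmf p)) i"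

text \<open>A tuple \<open>(k\<^sub>1, \<dots>, k\<^sub>\<nu>)\<close> is a function on \<open>{1..\<nu>}\<close>, extensional so that it is determined
  by its entries.\<close>

definition weighted_solutions :: "nat \<Rightarrow> (nat \<Rightarrow> nat) set" where
  "weighted_solutions \<nu> = {k \<in> {1..\<nu>} \<rightarrow>\<^sub>E UNIV. (\<Sum>m=1..\<nu>. m * k m) = \<nu>}"

lemma finite_weighted_solutions: "finite (weighted_solutions \<nu>)"
proof (rule finite_subset)
  show "weighted_solutions \<nu> \<subseteq> {1..\<nu>} \<rightarrow>\<^sub>E {..\<nu>}"
  proof
    fix k assume k: "k \<in> weighted_solutions \<nu>"
    have "k m \<le> \<nu>" if m: "m \<in> {1..\<nu>}" for m
    proof -
      have "k m \<le> m * k m" using m by simp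
      also have "\<dots> \<le> (\<Sum>m=1..\<nu>. m * k m)"
        using m by (intro member_le_sum) auto
      also have "\<dots> = \<nu>" using k by (simp add: weighted_solutions_def)
      finally show ?thesis .
    qed
    then show "k \<in> {1..\<nu>} \<rightarrow>\<^sub>E {..\<nu>}"
      using k by (auto simp: weighted_solutions_def PiE_def)
  qed
qed (simp add: finite_PiE)

definition q_tilde :: "real \<Rightarrow> nat \<Rightarrow> real \<Rightarrow> real" where
  "q_tilde p \<nu> x =
     (\<Sum>k\<in>weighted_solutions \<nu>.
        let s = (\<Sum>m=1..\<nu>. k m) in
          1 / 2 powr (real \<nu> / 2 + real s) * hermite (\<nu> + 2 * s) x *
          (\<Prod>m=1..\<nu>. 1 / fact (k m) *
             (bernoulli_cumulant p (m + 2) /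
                (fact (m + 2) * sqrt (p * (1 - p)) ^ (m + 2))) ^ k m))"

lemma q_tilde_0: "q_tilde p 0 x = 1"
  by (simp add: q_tilde_def weighted_solutions_def hermite_def flip: exp_add)

definition g_tilde :: "real \<Rightarrow> nat \<Rightarrow> nat \<Rightarrow> real \<Rightarrow> real" where
  "g_tilde p \<nu> r x = exp (x\<^sup>2) * (deriv ^^ r) (\<lambda>t. exp (- (t\<^sup>2)) * q_tilde p \<nu> t) x"

definition psi :: "real \<Rightarrow> nat \<Rightarrow> nat \<Rightarrow> nat \<Rightarrow> real \<Rightarrow> real" where
  "psi p N K s x =
     (\<Sum>i\<le>K. exp_coeff s i *
        (\<Sum>\<nu>\<le>K - i. g_tilde p \<nu> (s + i) x / real N powr (real \<nu> / 2) * step p N ^ (s + i)))"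

end

theory Submission
  imports Defs "HOL-Complex_Analysis.Complex_Analysis" "HOL-Real_Asymp.Real_Asymp"
begin

text \<open>Rodrigues' formula writes \<open>\<rho> k_n\<close> as the \<open>n\<close>-th forward difference of \<open>y (y - 1) \<dots> (y - n + 1) \<rho>(y)\<close>
  up to a constant, so the Leibniz rule reduces the expansion to one of the differences of \<open>\<rho>\<close>.

  For real \<open>y\<close> the weight \<open>\<rho>(y)\<close> is, up to an exponentially small error, the Fourier coefficient
  \<open>(1 / 2\<pi>) \<integral> (q + p e^(it))^N e^(-iyt) dt\<close> over \<open>[-\<pi>, \<pi>]\<close>, and an \<open>s\<close>-fold difference inserts the factor
  \<open>(e^(-it) - 1)^s\<close>. With \<open>w = it\<close> and \<open>z = N w^2\<close> the integrand is a Gaussian times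
  \<open>(e^(-w) - 1)^s exp (z E(w))\<close> with \<open>E(0) = 0\<close>. Expanding this in powers of \<open>w\<close> with \<open>z\<close> held fixed gives the
  terms of \<open>\<psi>\<close>; Cauchy's estimate bounds the remainder of order \<open>m\<close> by \<open>\<bar>t\<bar>^m\<close> times a Gaussian
  of variance proportional to \<open>1 / N\<close>, whose integral is of order \<open>N^(-(m + 1) / 2)\<close>.\<close>

section \<open>Forward differences and Rodrigues' formula\<close>

text \<open>In general \<open>xhat\<close> is not an integer, so Fourier inversion of the binomial
  law does not apply directly: off the integers the Fourier coefficient interpolates the
  probabilities by sinc functions, the weight by Gamma functions. The two differ by at most a
  constant depending on \<open>p\<close> times \<open>\<bar>1 - 2 * p\<bar> ^ N\<close>.

  Fixing \<open>z = N w^2\<close> fits the scale \<open>t ~ N^(-1/2)\<close>: there \<open>z\<close>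
  is of order one and each power of \<open>w\<close> gains \<open>N^(-1/2)\<close>. Since
  \<open>(e^(-w) - 1)^s\<close> has a zero of order \<open>s\<close>, an \<open>s\<close>-fold
  difference is of order \<open>N^(-(s + 1) / 2)\<close>, and keeping \<open>K + 1\<close> orders
  from there on leaves an error of order \<open>N^(-(s + K + 2) / 2)\<close>.

  These orders fix the shape of the result. The \<open>k\<close>-th Leibniz term has
  \<open>s = n - k\<close> and a falling factorial of order \<open>N^s\<close>. With
  \<open>K = M\<close> its error is of order \<open>N^((s - M - 2) / 2)\<close>. For
  \<open>k > M\<close> the whole term is of order \<open>N^((s - 1) / 2)\<close>, which the error
  already covers; hence the sum stops at \<open>M\<close>.

  The bounds are uniform over all \<open>x\<close> whose shifted arguments stay in
  \<open>[0, N]\<close>; \<open>\<bar>x\<bar> \<le> A\<close> ensures this for large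
  \<open>N\<close>.\<close>

definition fwd_diff :: "(real \<Rightarrow> real) \<Rightarrow> real \<Rightarrow> real" where
  "fwd_diff f y = f (y + 1) - f y"

text \<open>Pascal's rule in summed form: the induction step of the Leibniz rule, of the formula for
  iterated differences and of the partial fraction expansion.\<close>

lemma sum_binomial_pascal:
  fixes t :: "nat \<Rightarrow> 'a::comm_semiring_1"
  shows "(\<Sum>k\<le>n. of_nat (n choose k) * (t k + t (Suc k))) = (\<Sum>k\<le>Suc n. of_nat (Suc n choose k) * t k)"
proof -
  have "(\<Sum>k\<le>Suc n. of_nat (Suc n choose k) * t k)
      = t 0 + (\<Sum>k\<le>n. of_nat (n choose Suc k) * t (Suc k)) + (\<Sum>k\<le>n. of_nat (n choose k) * t (Suc k))"
    by (subst sum.atMost_Suc_shift) (simp add: algebra_simps sum.distrib)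
  also have "t 0 + (\<Sum>k\<le>n. of_nat (n choose Suc k) * t (Suc k)) = (\<Sum>k\<le>Suc n. of_nat (n choose k) * t k)"
    by (subst sum.atMost_Suc_shift) simp
  also have "\<dots> = (\<Sum>k\<le>n. of_nat (n choose k) * t k)"
    by (simp add: binomial_eq_0)
  finally show ?thesis
    by (simp add: distrib_left sum.distrib)
qed

lemma fwd_diff_funpow_Suc:
  "(fwd_diff ^^ Suc n) f y = (fwd_diff ^^ n) f (y + 1) - (fwd_diff ^^ n) f y"
  by (simp add: fwd_diff_def)

text \<open>Built on \<open>\<Delta>(f g)(y) = f(y + 1) \<Delta>g(y) + \<Delta>f(y) g(y)\<close>, so
  that all shifts fall on \<open>f\<close>. With \<open>f\<close> the falling factorial, the
  differences of the weight are all taken at the same point \<open>y\<close>.\<close>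

lemma fwd_diff_mult:
  "(fwd_diff ^^ n) (\<lambda>y. f y * g y) y
     = (\<Sum>k\<le>n. real (n choose k) * ((fwd_diff ^^ k) f (y + real (n - k)) * (fwd_diff ^^ (n - k)) g y))"
proof (induction n arbitrary: y)
  case (Suc n)
  let ?t = "\<lambda>k. (fwd_diff ^^ k) f (y + real (Suc n - k)) * (fwd_diff ^^ (Suc n - k)) g y"
  have "(fwd_diff ^^ Suc n) (\<lambda>y. f y * g y) y
      = (\<Sum>k\<le>n. real (n choose k) * ((fwd_diff ^^ k) f (y + 1 + real (n - k)) * (fwd_diff ^^ (n - k)) g (y + 1)) -
         real (n choose k) * ((fwd_diff ^^ k) f (y + real (n - k)) * (fwd_diff ^^ (n - k)) g y))"
    by (simp only: fwd_diff_funpow_Suc Suc.IH sum_subtractf)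
  also have "\<dots> = (\<Sum>k\<le>n. real (n choose k) * (?t k + ?t (Suc k)))"
  proof (rule sum.cong[OF refl])
    fix k assume "k \<in> {..n}"
    then have "Suc n - k = Suc (n - k)" by auto
    moreover have "y + 1 + real (n - k) = y + real (n - k) + 1" by simp
    ultimately
    show "real (n choose k) * ((fwd_diff ^^ k) f (y + 1 + real (n - k)) * (fwd_diff ^^ (n - k)) g (y + 1)) -
         real (n choose k) * ((fwd_diff ^^ k) f (y + real (n - k)) * (fwd_diff ^^ (n - k)) g y) =
         real (n choose k) * (?t k + ?t (Suc k))"
      by (simp add: fwd_diff_funpow_Suc algebra_simps del: funpow.simps)
  qed
  also have "\<dots> = (\<Sum>k\<le>Suc n. real (Suc n choose k) * ?t k)"
    by (rule sum_binomial_pascal)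
  finally show ?case .
qed simp

lemma fwd_diff_funpow:
  "(fwd_diff ^^ n) f y = (\<Sum>l\<le>n. real (n choose l) * ((- 1) ^ (n - l) * f (y + real l)))"
proof (induction n arbitrary: y)
  case (Suc n)
  let ?t = "\<lambda>l. (- 1) ^ (Suc n - l) * f (y + real l)"
  have "(fwd_diff ^^ Suc n) f y = (\<Sum>l\<le>n. real (n choose l) * (?t l + ?t (Suc l)))"
    unfolding fwd_diff_funpow_Suc Suc.IH sum_subtractf[symmetric]
    by (rule sum.cong[OF refl]) (simp add: Suc_diff_le algebra_simps)
  also have "\<dots> = (\<Sum>k\<le>Suc n. real (Suc n choose k) * ?t k)"
    by (rule sum_binomial_pascal)
  finally show ?case .
qed simp

section \<open>Falling factorials and the Krawtchouk polynomials\<close>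

lemma ffact_conv_gbinomial: "ffact y k = fact k * (y gchoose k)"
  by (simp add: ffact_def gbinomial_prod_rev atLeast0LessThan)

lemma ffact_conv_pochhammer: "ffact y k = (- 1) ^ k * pochhammer (- y) k"
  by (simp add: ffact_conv_gbinomial gbinomial_pochhammer)

lemma ffact_conv_pochhammer': "ffact y k = pochhammer (y - real k + 1) k"
  by (simp add: ffact_conv_gbinomial gbinomial_pochhammer')

lemma ffact_add: "ffact y (k + l) = ffact y k * ffact (y - real k) l"
  by (simp add: ffact_conv_pochhammer pochhammer_product' power_add)

lemma ffact_Suc_left: "ffact y (Suc k) = y * ffact (y - 1) k"
  using ffact_add[of y 1 k] by (simp add: ffact_def)

lemma ffact_Suc_right: "ffact y (Suc k) = ffact y k * (y - real k)"
  by (simp add: ffact_def)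

lemma fwd_diff_ffact: "fwd_diff (\<lambda>y. ffact y (Suc n)) y = real (Suc n) * ffact y n"
  using ffact_Suc_left[of "y + 1" n] ffact_Suc_right[of y n]
  by (simp add: fwd_diff_def algebra_simps)

lemma fwd_diff_funpow_ffact:
  assumes "k \<le> n"
  shows "(fwd_diff ^^ k) (\<lambda>y. ffact y n) y = ffact (real n) k * ffact y (n - k)"
  using assms
proof (induction k arbitrary: y)
  case (Suc k)
  then obtain m where m: "n - k = Suc m" "n - Suc k = m" by (metis Suc_diff_Suc Suc_le_eq)
  from Suc.prems have nk: "real n - real k = real (Suc m)" using m by linarith
  have "(fwd_diff ^^ Suc k) (\<lambda>y. ffact y n) y
      = fwd_diff (\<lambda>y. ffact (real n) k * ffact y (Suc m)) y"
    unfolding fwd_diff_funpow_Suc fwd_diff_def using Suc.IH Suc.prems m by (simp flip: fwd_diff_def)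
  also have "\<dots> = ffact (real n) k * fwd_diff (\<lambda>y. ffact y (Suc m)) y"
    by (simp add: fwd_diff_def algebra_simps)
  also have "\<dots> = ffact (real n) (Suc k) * ffact y m"
    by (simp only: fwd_diff_ffact) (simp add: ffact_Suc_right nk)
  finally show ?case using m by simp
qed (simp add: ffact_def)

text \<open>A shift by \<open>l\<close> changes each Gamma value by a falling factorial. The one
  from \<open>Gamma (1 + y)\<close> cancels the first \<open>l\<close> factors of
  \<open>ffact (y + l) n\<close>, which leaves the weight at \<open>y\<close> times a polynomial in
  \<open>y\<close>.\<close>

lemma weight_shift:
  assumes p: "0 < p" "p < 1" and y: "0 \<le> y" "y + real l \<le> real N" and l: "l \<le> n"
  shows "ffact (y + real l) n * weight p N (y + real l)
       = weight p N y * (p / (1 - p)) ^ l * ffact (real N - y) l * ffact y (n - l)"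
proof -
  have pos: "Gamma (1 + y) > 0" "Gamma (real N + 1 - (y + real l)) > 0" "ffact (y + real l) l > 0"
    "ffact (real N - y) l > 0"
    using y by (auto intro!: Gamma_real_pos prod_pos simp: ffact_def)
  have G1: "Gamma (1 + (y + real l)) = Gamma (1 + y) * ffact (y + real l) l"
    using pochhammer_Gamma[of "1 + y" l] y pos(1)
    by (auto simp: ffact_conv_pochhammer' add_ac field_simps nonpos_Ints_def)
  have G2: "Gamma (real N + 1 - y) = Gamma (real N + 1 - (y + real l)) * ffact (real N - y) l"
  proof -
    define z where "z = real N + 1 - (y + real l)"
    have "z > 0" using y by (simp add: z_def)
    then have "pochhammer z l = Gamma (z + real l) / Gamma z" "Gamma z > 0"
      using pochhammer_Gamma[of z l] by (auto simp: nonpos_Ints_def Gamma_real_pos)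
    moreover have "z + real l = real N + 1 - y" "real N - y - real l + 1 = z" by (simp_all add: z_def)
    ultimately show ?thesis by (simp add: ffact_conv_pochhammer' flip: z_def)
  qed
  have F: "ffact (y + real l) n = ffact (y + real l) l * ffact y (n - l)"
    using ffact_add[of "y + real l" l "n - l"] l by simp
  have P: "p powr (y + real l) = p powr y * p ^ l"
    using p by (simp add: powr_add powr_realpow)
  have Q: "(1 - p) powr (real N - (y + real l)) = (1 - p) powr (real N - y) / (1 - p) ^ l"
    using p by (simp add: powr_diff powr_realpow flip: diff_diff_eq)
  show ?thesis
    unfolding weight_def G1 G2 F P Q using pos p by (simp add: field_simps)
qed

text \<open>The factor \<open>N choose n\<close> clears the denominators of the hypergeometric sum:
  by trinomial revision \<open>(N choose n) (n choose j) / (N choose j)\<close> is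
  \<open>N - j choose n - j\<close>. The divisor is nonzero because
  \<open>j \<le> n \<le> N\<close>.\<close>

lemma krawtchouk_conv_gbinomial:
  assumes p: "0 < p" and nN: "n \<le> N"
  shows "krawtchouk p N n y
       = (\<Sum>j\<le>n. (y gchoose j) * (real N - real j gchoose (n - j)) * (- p) ^ (n - j))"
  unfolding krawtchouk_def krawtchouk_K_def sum_distrib_left
proof (rule sum.cong[OF refl])
  fix j assume "j \<in> {..n}"
  then have j: "j \<le> n" by simp
  have y: "pochhammer (- y) j = (- 1) ^ j * (fact j * (y gchoose j))"
    using ffact_conv_pochhammer[of y j] by (simp add: ffact_conv_gbinomial)
  have n: "pochhammer (- real n) j = (- 1) ^ j * (fact j * (real n gchoose j))"
    using ffact_conv_pochhammer[of "real n" j] by (simp add: ffact_conv_gbinomial)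
  have N: "pochhammer (- real N) j = (- 1) ^ j * (fact j * (real N gchoose j))"
    using ffact_conv_pochhammer[of "real N" j] by (simp add: ffact_conv_gbinomial)
  have N0: "real N gchoose j > 0"
    using j nN by (simp flip: binomial_gbinomial)
  have rev: "real (N choose n) * (real n gchoose j) = (real N gchoose j) * (real N - real j gchoose (n - j))"
    using gbinomial_trinomial_revision[of j n "real N"] j by (simp add: binomial_gbinomial)
  have pp: "(- p) ^ n * (1 / p) ^ j = (- 1) ^ j * (- p) ^ (n - j)"
  proof -
    have "(- p) ^ n = (- p) ^ j * (- p) ^ (n - j)" using j by (simp flip: power_add)
    then show ?thesis using p by (simp add: power_minus[of p j] field_simps)
  qed
  have "(- p) ^ n * real (N choose n) *
     (pochhammer (- y) j * pochhammer (- real n) j / (pochhammer (- real N) j * fact j) * (1 / p) ^ j)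
     = ((- p) ^ n * (1 / p) ^ j) * (- 1) ^ j * (y gchoose j) * (real (N choose n) * (real n gchoose j)) / (real N gchoose j)"
    unfolding y n N using N0 by (cases "even j") (simp_all add: field_simps)
  also have "\<dots> = (y gchoose j) * (real N - real j gchoose (n - j)) * (- p) ^ (n - j)"
    unfolding pp rev using N0 by (simp flip: power_mult_distrib)
  finally show "(- p) ^ n * real (N choose n) *
     (pochhammer (- y) j * pochhammer (- real n) j / (pochhammer (- real N) j * fact j) * (1 / p) ^ j)
     = (y gchoose j) * (real N - real j gchoose (n - j)) * (- p) ^ (n - j)" .
qed

lemma sum_triangle_swap:
  fixes f :: "nat \<Rightarrow> nat \<Rightarrow> 'a::comm_monoid_add"
  shows "(\<Sum>l\<le>n. \<Sum>i\<le>n - l. f l i) = (\<Sum>i\<le>n. \<Sum>l\<le>n - i. f l i)"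
proof -
  have "(\<Sum>l\<le>n. \<Sum>i\<le>n - l. f l i) = (\<Sum>l\<le>n. \<Sum>i | i \<in> {..n} \<and> l + i \<le> n. f l i)"
    by (intro sum.cong refl) auto
  also have "\<dots> = (\<Sum>i\<le>n. \<Sum>l | l \<in> {..n} \<and> l + i \<le> n. f l i)"
    by (rule sum.swap_restrict) auto
  also have "\<dots> = (\<Sum>i\<le>n. \<Sum>l\<le>n - i. f l i)"
    by (intro sum.cong refl) auto
  finally show ?thesis .
qed

text \<open>Both sides are the coefficient of \<open>z^n\<close> in \<open>(1 - p z)^(N - y) (1 + (1 - p) z)^y\<close>.\<close>

lemma krawtchouk_coefficient_identity:
  fixes p y N :: real
  shows "(\<Sum>l\<le>n. (N - y gchoose l) * (y gchoose (n - l)) * (- p) ^ l * (1 - p) ^ (n - l))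
       = (\<Sum>j\<le>n. (y gchoose j) * (N - real j gchoose (n - j)) * (- p) ^ (n - j))"
proof -
  have "(\<Sum>l\<le>n. (N - y gchoose l) * (y gchoose (n - l)) * (- p) ^ l * (1 - p) ^ (n - l))
     = (\<Sum>l\<le>n. \<Sum>i\<le>n - l. (y gchoose i) * (- p) ^ (n - i) * ((N - y gchoose l) * (y - real i gchoose (n - i - l))))"
  proof (rule sum.cong[OF refl])
    fix l assume "l \<in> {..n}"
    \<comment> \<open>Expanding \<open>1 - p\<close> as \<open>1 + (- p)\<close> makes the total
      power of \<open>- p\<close> equal to \<open>n - i\<close>, independent of \<open>l\<close>.
      After trinomial revision the sum over \<open>l\<close> is a Vandermonde convolution.\<close>
    have "(1 - p) ^ (n - l) = (\<Sum>i\<le>n - l. real (n - l choose i) * (- p) ^ (n - l - i))"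
      using binomial_ring[of 1 "- p" "n - l"] by simp
    then have "(N - y gchoose l) * (y gchoose (n - l)) * (- p) ^ l * (1 - p) ^ (n - l) =
      (\<Sum>i\<le>n - l. (N - y gchoose l) * (y gchoose (n - l)) * (- p) ^ l * (real (n - l choose i) * (- p) ^ (n - l - i)))"
      by (simp add: sum_distrib_left)
    also have "\<dots> = (\<Sum>i\<le>n - l. (y gchoose i) * (- p) ^ (n - i) * ((N - y gchoose l) * (y - real i gchoose (n - i - l))))"
    proof (rule sum.cong[OF refl])
      fix i assume i: "i \<in> {..n - l}"
      have e: "n - l - i = n - i - l" by simp
      have "(y gchoose (n - l)) * real (n - l choose i) = (y gchoose i) * (y - real i gchoose (n - i - l))"
        using gbinomial_trinomial_revision[of i "n - l" y] i unfolding e by (simp add: binomial_gbinomial)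
      moreover have "(- p) ^ l * (- p) ^ (n - l - i) = (- p) ^ (n - i)"
        using i \<open>l \<in> {..n}\<close> by (simp flip: power_add)
      moreover have "(N - y gchoose l) * (y gchoose (n - l)) * (- p) ^ l * (real (n - l choose i) * (- p) ^ (n - l - i))
        = (N - y gchoose l) * ((y gchoose (n - l)) * real (n - l choose i)) * ((- p) ^ l * (- p) ^ (n - l - i))"
        by (simp only: mult_ac)
      ultimately show "(N - y gchoose l) * (y gchoose (n - l)) * (- p) ^ l * (real (n - l choose i) * (- p) ^ (n - l - i))
        = (y gchoose i) * (- p) ^ (n - i) * ((N - y gchoose l) * (y - real i gchoose (n - i - l)))"
        by (simp only: mult_ac)
    qed
    finally show "(N - y gchoose l) * (y gchoose (n - l)) * (- p) ^ l * (1 - p) ^ (n - l) = \<dots>" .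
  qed
  also have "\<dots> = (\<Sum>i\<le>n. \<Sum>l\<le>n - i. (y gchoose i) * (- p) ^ (n - i) * ((N - y gchoose l) * (y - real i gchoose (n - i - l))))"
    by (rule sum_triangle_swap)
  also have "\<dots> = (\<Sum>j\<le>n. (y gchoose j) * (N - real j gchoose (n - j)) * (- p) ^ (n - j))"
  proof (rule sum.cong[OF refl])
    fix i assume "i \<in> {..n}"
    have "(\<Sum>l\<le>n - i. (N - y gchoose l) * (y - real i gchoose (n - i - l))) = (N - real i gchoose (n - i))"
      using gbinomial_Vandermonde[of "N - y" "y - real i" "n - i"] by (simp add: atLeast0AtMost)
    then show "(\<Sum>l\<le>n - i. (y gchoose i) * (- p) ^ (n - i) * ((N - y gchoose l) * (y - real i gchoose (n - i - l))))
      = (y gchoose i) * (N - real i gchoose (n - i)) * (- p) ^ (n - i)"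
      by (simp flip: sum_distrib_left)
  qed
  finally show ?thesis .
qed

text \<open>In the explicit form of the difference every value at \<open>y + l\<close> is the weight
  at \<open>y\<close> times a polynomial, by \<open>weight_shift\<close>; what remains is
  \<open>krawtchouk_coefficient_identity\<close>.\<close>

lemma krawtchouk_rodrigues:
  assumes p: "0 < p" "p < 1" and y: "0 \<le> y" "y + real n \<le> real N"
  shows "weight p N y * krawtchouk p N n y
       = (- (1 - p)) ^ n / fact n * (fwd_diff ^^ n) (\<lambda>y. ffact y n * weight p N y) y"
proof -
  have nN: "n \<le> N" using y by linarith
  have "(- (1 - p)) ^ n / fact n * (fwd_diff ^^ n) (\<lambda>y. ffact y n * weight p N y) y
     = (\<Sum>l\<le>n. weight p N y * ((real N - y gchoose l) * (y gchoose (n - l)) * (- p) ^ l * (1 - p) ^ (n - l)))"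
    unfolding fwd_diff_funpow sum_distrib_left
  proof (rule sum.cong[OF refl])
    fix l assume "l \<in> {..n}"
    then have l: "l \<le> n" by simp
    have w: "ffact (y + real l) n * weight p N (y + real l)
       = weight p N y * (p / (1 - p)) ^ l * ffact (real N - y) l * ffact y (n - l)"
      using y l by (intro weight_shift p) auto
    have b: "real (n choose l) = fact n / (fact l * fact (n - l))"
      using l by (simp add: binomial_fact)
    have s: "(- q) ^ n * (- 1) ^ (n - l) * (p / q) ^ l = (- p) ^ l * q ^ (n - l)" if "q > 0" for q
    proof -
      have "(- q) ^ n = (- q) ^ l * (- q) ^ (n - l)"
        using l by (simp flip: power_add)
      then show ?thesis
        using that by (cases "even l"; cases "even (n - l)") (simp_all add: power_divide)
    qed
    show "(- (1 - p)) ^ n / fact n * (real (n choose l) * ((- 1) ^ (n - l) * (ffact (y + real l) n * weight p N (y + real l))))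
       = weight p N y * ((real N - y gchoose l) * (y gchoose (n - l)) * (- p) ^ l * (1 - p) ^ (n - l))"
      (is "?L = ?R")
    proof -
      have "?L = ((- (1 - p)) ^ n * (- 1) ^ (n - l) * (p / (1 - p)) ^ l) * weight p N y
                 * (real N - y gchoose l) * (y gchoose (n - l))"
        unfolding w b by (simp add: ffact_conv_gbinomial field_simps)
      then show ?thesis using s[of "1 - p"] p by (simp add: mult_ac)
    qed
  qed
  also have "\<dots> = weight p N y * krawtchouk p N n y"
    unfolding krawtchouk_conv_gbinomial[OF p(1) nN] sum_distrib_left[symmetric] krawtchouk_coefficient_identity ..
  finally show ?thesis by simp
qed

lemma krawtchouk_expansion_fwd_diff:
  assumes p: "0 < p" "p < 1" and y: "0 \<le> y" "y + real n \<le> real N"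
  shows "weight p N y * krawtchouk p N n y
       = (- (1 - p)) ^ n / fact n *
         (\<Sum>k\<le>n. real (n choose k) * ffact (real n) k * ffact (y + real (n - k)) (n - k)
                 * (fwd_diff ^^ (n - k)) (weight p N) y)"
  unfolding krawtchouk_rodrigues[OF assms] fwd_diff_mult
  by (rule arg_cong[where f = "(*) _"], rule sum.cong) (simp_all add: fwd_diff_funpow_ffact)

section \<open>The weight as a Fourier coefficient\<close>

lemma prod_atMost_shift_diff:
  fixes y :: real
  shows "(\<Prod>j\<le>Suc N. y - real j) = y * (\<Prod>j\<le>N. y - 1 - real j)"
  by (subst prod.atMost_Suc_shift) (simp add: algebra_simps)

text \<open>The sum is an iterated difference of a reciprocal, so Pascal's rule writes the case
  \<open>Suc N\<close> as the case \<open>N\<close> at \<open>y\<close> minus the case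
  \<open>N\<close> at \<open>y - 1\<close>. The two products share all but their extreme
  factors.\<close>

lemma binomial_partial_fractions:
  fixes y :: real
  assumes "\<And>j. j \<le> N \<Longrightarrow> y \<noteq> real j"
  shows "(\<Sum>j\<le>N. real (N choose j) * ((- 1) ^ j / (y - real j))) = (- 1) ^ N * fact N / (\<Prod>j\<le>N. y - real j)"
  using assms
proof (induction N arbitrary: y)
  case (Suc N)
  let ?t = "\<lambda>j. (- 1) ^ j / (y - real j)"
  have nz: "y \<noteq> real j" if "j \<le> Suc N" for j using Suc.prems that by auto
  have nz': "y - 1 \<noteq> real j" if "j \<le> N" for j using nz[of "Suc j"] that by auto
  let ?A = "\<Prod>j\<le>N. y - real j" and ?B = "\<Prod>j\<le>N. y - 1 - real j"
  have AB: "?A * (y - real (Suc N)) = y * ?B"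
    using prod_atMost_shift_diff[of y N] by simp
  have nz2: "?A \<noteq> 0" "?B \<noteq> 0" "y \<noteq> 0" "y - real (Suc N) \<noteq> 0"
    using nz nz' nz[of 0] nz[of "Suc N"] by auto
  have "(\<Sum>j\<le>Suc N. real (Suc N choose j) * ?t j) = (\<Sum>j\<le>N. real (N choose j) * (?t j + ?t (Suc j)))"
    by (rule sum_binomial_pascal[symmetric])
  also have "\<dots> = (\<Sum>j\<le>N. real (N choose j) * ((- 1) ^ j / (y - real j)))
               - (\<Sum>j\<le>N. real (N choose j) * ((- 1) ^ j / (y - 1 - real j)))"
    unfolding sum_subtractf[symmetric]
    by (rule sum.cong) (auto simp: algebra_simps)
  also have "\<dots> = (- 1) ^ N * fact N * (1 / ?A - 1 / ?B)"
    using Suc.IH[of y] Suc.IH[of "y - 1"] nz nz' by (simp add: algebra_simps)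
  also have "1 / ?A = (y - real (Suc N)) / (?A * (y - real (Suc N)))"
    using nz2(4) by (rule nonzero_divide_mult_cancel_right[symmetric])
  also have "1 / ?B = y / (?A * (y - real (Suc N)))"
    unfolding AB using nz2(3) by simp
  finally show ?case by (simp add: diff_divide_distrib[symmetric] field_simps)
qed simp

lemma Gamma_reflection_real:
  fixes y :: real
  shows "Gamma y * Gamma (1 - y) = pi / sin (pi * y)"
proof -
  have "complex_of_real (Gamma y * Gamma (1 - y)) = of_real (pi / sin (pi * y))"
    using Gamma_reflection_complex[of "of_real y"]
    by (simp flip: Gamma_complex_of_real sin_of_real)
  then show ?thesis using of_real_eq_iff by blast
qed

text \<open>Once both arguments are pulled back to \<open>y\<close> and \<open>1 - y\<close>,
  reflection yields \<open>sin (\<pi> y)\<close>, and the reciprocal of the remaining polynomial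
  \<open>y (y - 1) \<dots> (y - N)\<close> splits into partial fractions. In this form the weight is
  comparable term by term with the Fourier coefficient.\<close>

lemma binomial_Gamma_sinc_series:
  fixes y :: real
  assumes y: "y \<notin> \<int>"
  shows "fact N / (Gamma (1 + y) * Gamma (real N + 1 - y))
       = sin (pi * y) / pi * (\<Sum>j\<le>N. real (N choose j) * ((- 1) ^ j / (y - real j)))"
proof -
  have nz: "y \<noteq> real j" for j using y by auto
  have "1 - y \<notin> \<int>" using y by (metis Ints_1 Ints_diff diff_diff_eq2 add_diff_cancel_left')
  then have "pochhammer (1 - y) N = Gamma (1 - y + real N) / Gamma (1 - y)"
    by (intro pochhammer_Gamma) (metis nonpos_Ints_Int)
  moreover have G1: "Gamma (1 - y) \<noteq> 0"
    using \<open>1 - y \<notin> \<int>\<close> by (metis Gamma_eq_zero_iff nonpos_Ints_Int)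
  ultimately have G2: "Gamma (real N + 1 - y) = Gamma (1 - y) * pochhammer (1 - y) N"
    by (simp add: algebra_simps)
  have Gy: "Gamma (1 + y) = y * Gamma y"
    using Gamma_plus1[of y] y by (simp add: add.commute nonpos_Ints_def) (metis Ints_of_int)
  have P: "(\<Prod>j\<le>N. y - real j) = y * (- 1) ^ N * pochhammer (1 - y) N"
  proof -
    have "(\<Prod>j\<le>N. y - real j) = y * (\<Prod>j<N. - (1 - y + real j))"
      by (subst lessThan_Suc_atMost[symmetric], subst prod.lessThan_Suc_shift) (simp add: algebra_simps)
    then show ?thesis
      by (simp only: prod_uminus pochhammer_prod atLeast0LessThan card_lessThan mult.assoc)
  qed
  have s0: "sin (pi * y) \<noteq> 0"
    using y by (auto simp: sin_zero_iff_int2)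
  have "fact N / (Gamma (1 + y) * Gamma (real N + 1 - y))
      = fact N / (y * (Gamma y * Gamma (1 - y)) * pochhammer (1 - y) N)"
    unfolding Gy G2 by (simp add: mult_ac)
  also have "\<dots> = sin (pi * y) / pi * ((- 1) ^ N * fact N / (\<Prod>j\<le>N. y - real j))"
    unfolding Gamma_reflection_real P using s0 by (cases "even N") (simp_all add: field_simps)
  also have "\<dots> = sin (pi * y) / pi * (\<Sum>j\<le>N. real (N choose j) * ((- 1) ^ j / (y - real j)))"
    by (subst binomial_partial_fractions) (use nz in auto)
  finally show ?thesis .
qed

lemma integral_indicator_iexp:
  fixes c :: real
  shows "(LINT t|lborel. indicator {- pi..pi} t *\<^sub>R exp (\<i> * of_real (c * t)))
       = of_real (if c = 0 then 2 * pi else 2 * sin (pi * c) / c)"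
proof (cases "c = 0")
  case False
  have "(LINT t|lborel. indicator {- pi..pi} t *\<^sub>R exp (\<i> * of_real (c * t)))
     = exp (\<i> * of_real (c * pi)) / (\<i> * of_real c) - exp (\<i> * of_real (c * (- pi))) / (\<i> * of_real c)"
  proof (rule integral_FTC_atLeastAtMost)
    fix t
    have "((\<lambda>z. exp (\<i> * (of_real c * z)) / (\<i> * of_real c)) has_field_derivative exp (\<i> * of_real (c * t))) (at (of_real t))"
      using False by (auto intro!: derivative_eq_intros simp: mult_ac)
    from has_vector_derivative_real_field[OF this]
    show "((\<lambda>t. exp (\<i> * of_real (c * t)) / (\<i> * of_real c)) has_vector_derivative exp (\<i> * of_real (c * t)))
        (at t within {- pi..pi})" by simp
  qed (auto intro!: continuous_intros)
  also have "\<dots> = of_real (2 * sin (pi * c) / c)"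
  proof -
    have "exp (\<i> * of_real (c * pi)) - exp (\<i> * of_real (c * (- pi))) = 2 * \<i> * of_real (sin (pi * c))"
      unfolding cis_conv_exp[symmetric] by (simp add: complex_eq_iff mult.commute)
    then show ?thesis using False by (simp add: diff_divide_distrib[symmetric])
  qed
  finally show ?thesis using False by simp
qed (simp add: scaleR_conv_of_real)

lemma integral_sum_mult_left:
  fixes F :: "'i \<Rightarrow> 'b \<Rightarrow> 'a::{real_normed_field, banach, second_countable_topology}"
  assumes "\<And>l. integrable M (F l)"
  shows "(LINT t|M. (\<Sum>l\<in>A. c l * F l t)) = (\<Sum>l\<in>A. c l * (LINT t|M. F l t))"
  using assms by (subst Bochner_Integration.integral_sum) auto

section \<open>The binomial characteristic function integrated over one period\<close>

definition char_integral :: "real \<Rightarrow> nat \<Rightarrow> real \<Rightarrow> complex" where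
  "char_integral p N y = (LINT t|lborel. indicator {- pi..pi} t *\<^sub>R
     (exp (- (\<i> * of_real (y * t))) * (of_real (1 - p) + of_real p * exp (\<i> * of_real t)) ^ N)) / of_real (2 * pi)"

text \<open>Integrating the binomial expansion termwise gives the sinc interpolation of the binomial
  probabilities; the case \<open>y = j\<close> is the removable singularity of sinc.\<close>

lemma char_integral_conv_sum:
  "char_integral p N y = of_real (\<Sum>j\<le>N. real (N choose j) * p ^ j * (1 - p) ^ (N - j) *
      (if y = real j then 1 else sin (pi * (real j - y)) / (pi * (real j - y))))"
proof -
  have e: "exp (- (\<i> * of_real (y * t))) * (of_real (1 - p) + of_real p * exp (\<i> * of_real t)) ^ N
     = (\<Sum>j\<le>N. of_real (real (N choose j) * p ^ j * (1 - p) ^ (N - j)) * exp (\<i> * of_real ((real j - y) * t)))" for t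
  proof -
    have "(of_real (1 - p) + of_real p * exp (\<i> * of_real t)) ^ N
      = (\<Sum>j\<le>N. of_nat (N choose j) * (of_real p * exp (\<i> * of_real t)) ^ j * (of_real (1 - p)) ^ (N - j))"
      by (subst add.commute) (rule binomial_ring)
    moreover have ee: "exp (- (\<i> * of_real (y * t))) * exp (\<i> * of_real t) ^ j = exp (\<i> * of_real ((real j - y) * t))" for j
      by (simp add: algebra_simps flip: exp_of_nat_mult exp_add)
    ultimately show ?thesis
      by (simp only: sum_distrib_left ee[symmetric]) (simp add: power_mult_distrib mult_ac)
  qed
  have "continuous_on {- pi..pi} (\<lambda>t. exp (\<i> * complex_of_real (c * t)))" for c
    by (intro continuous_intros)
  then have int: "integrable lborel (\<lambda>t. indicator {- pi..pi} t *\<^sub>R exp (\<i> * complex_of_real (c * t)))" for c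
    using borel_integrable_atLeastAtMost' unfolding set_integrable_def by blast
  have "(LINT t|lborel. indicator {- pi..pi} t *\<^sub>R
     (exp (- (\<i> * of_real (y * t))) * (of_real (1 - p) + of_real p * exp (\<i> * of_real t)) ^ N))
    = (LINT t|lborel. (\<Sum>j\<le>N. of_real (real (N choose j) * p ^ j * (1 - p) ^ (N - j)) *
         (indicator {- pi..pi} t *\<^sub>R exp (\<i> * of_real ((real j - y) * t)))))"
    unfolding e by (simp add: scaleR_sum_right mult_ac)
  also have "\<dots> = (\<Sum>j\<le>N. of_real (real (N choose j) * p ^ j * (1 - p) ^ (N - j)) *
      of_real (if real j - y = 0 then 2 * pi else 2 * sin (pi * (real j - y)) / (real j - y)))"
    by (subst integral_sum_mult_left[OF int]) (simp only: integral_indicator_iexp)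
  also have "\<dots> = of_real (2 * pi * (\<Sum>j\<le>N. real (N choose j) * p ^ j * (1 - p) ^ (N - j) *
      (if y = real j then 1 else sin (pi * (real j - y)) / (pi * (real j - y)))))"
    unfolding sum_distrib_left of_real_sum
    by (rule sum.cong[OF refl]) (auto simp flip: of_real_mult)
  finally show ?thesis unfolding char_integral_def by simp
qed

lemma char_integral_of_nat:
  assumes p: "0 < p" "p < 1" and m: "m \<le> N"
  shows "char_integral p N (real m) = of_real (weight p N (real m))"
proof -
  have "char_integral p N (real m) = of_real (\<Sum>j\<le>N. if j = m then real (N choose j) * p ^ j * (1 - p) ^ (N - j) else 0)"
    unfolding char_integral_conv_sum
  proof (intro arg_cong[where f = of_real] sum.cong refl)
    fix j assume "j \<in> {..N}"
    have "sin (pi * (real j - real m)) = 0"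
      by (simp add: sin_diff right_diff_distrib)
    then show "real (N choose j) * p ^ j * (1 - p) ^ (N - j) *
         (if real m = real j then 1 else sin (pi * (real j - real m)) / (pi * (real j - real m))) =
         (if j = m then real (N choose j) * p ^ j * (1 - p) ^ (N - j) else 0)" by simp
  qed
  also have "(\<Sum>j\<le>N. if j = m then real (N choose j) * p ^ j * (1 - p) ^ (N - j) else 0)
     = real (N choose m) * p ^ m * (1 - p) ^ (N - m)" using m by simp
  also have "\<dots> = weight p N (real m)"
  proof -
    have "real N - real m = real (N - m)" "real N + 1 - real m = 1 + real (N - m)" using m by auto
    then show ?thesis
      using p m unfolding weight_def \<open>real N - real m = _\<close> \<open>real N + 1 - real m = _\<close>
      by (simp add: Gamma_fact powr_realpow binomial_fact del: of_nat_diff)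
  qed
  finally show ?thesis .
qed

text \<open>With a variable \<open>v\<close> in place of \<open>L\<close>, the sum vanishes at
  \<open>0\<close> and differentiation cancels the denominators \<open>y - j\<close>, so by the
  binomial theorem the derivative is \<open>- exp (- v y) (1 - exp v)^N\<close>. Its modulus on the
  segment from \<open>0\<close> to \<open>L\<close> is largest at \<open>L\<close>, and the mean
  value inequality applies.\<close>

lemma alternating_binomial_exp_bound:
  fixes y L :: real
  assumes y: "0 \<le> y" "y \<le> real N" "y \<notin> \<int>"
  shows "\<bar>\<Sum>j\<le>N. real (N choose j) * ((- 1) ^ j / (y - real j)) * (exp (L * (real j - y)) - 1)\<bar>
       \<le> \<bar>L\<bar> * (exp (- (L * y)) * \<bar>1 - exp L\<bar> ^ N)"
proof -
  let ?h = "\<lambda>v. \<Sum>j\<le>N. real (N choose j) * ((- 1) ^ j / (y - real j)) * (exp (v * (real j - y)) - 1)"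
  have nz: "y \<noteq> real j" for j using y by auto
  have D: "(?h has_real_derivative - (exp (- (v * y)) * (1 - exp v) ^ N)) (at v)" for v
  proof -
    have binom: "(1 - exp v) ^ N = (\<Sum>j\<le>N. real (N choose j) * ((- 1) ^ j * exp (v * real j)))"
      using binomial_ring[of "- exp v" 1 N]
      by (simp add: power_minus[of "exp v"] mult_ac flip: exp_of_nat_mult)
    have "- (exp (- (v * y)) * (1 - exp v) ^ N)
       = (\<Sum>j\<le>N. real (N choose j) * ((- 1) ^ j / (y - real j)) * (exp (v * (real j - y)) * (real j - y)))"
      unfolding binom sum_distrib_left sum_negf[symmetric]
    proof (intro sum.cong refl)
      fix j
      have "exp (v * (real j - y)) = exp (- (v * y)) * exp (v * real j)"
        by (simp add: algebra_simps flip: exp_add)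
      moreover have "(real j - y) / (y - real j) = - 1" using nz[of j] by (simp add: field_simps)
      ultimately show "- (exp (- (v * y)) * (real (N choose j) * ((- 1) ^ j * exp (v * real j))))
        = real (N choose j) * ((- 1) ^ j / (y - real j)) * (exp (v * (real j - y)) * (real j - y))"
        using nz[of j] by (simp add: field_simps)
    qed
    moreover have "(?h has_real_derivative (\<Sum>j\<le>N. real (N choose j) * ((- 1) ^ j / (y - real j)) * (exp (v * (real j - y)) * (real j - y)))) (at v)"
    proof (intro DERIV_sum)
      fix j
      define c d where "c = real (N choose j) * ((- 1) ^ j / (y - real j))" and "d = real j - y"
      show "((\<lambda>v. real (N choose j) * ((- 1) ^ j / (y - real j)) * (exp (v * (real j - y)) - 1)) has_real_derivative
         real (N choose j) * ((- 1) ^ j / (y - real j)) * (exp (v * (real j - y)) * (real j - y))) (at v)"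
        unfolding c_def[symmetric] d_def[symmetric] by (auto intro!: derivative_eq_intros)
    qed
    ultimately show ?thesis by simp
  qed
  have bound: "exp (- (v * y)) * \<bar>1 - exp v\<bar> ^ N \<le> exp (- (L * y)) * \<bar>1 - exp L\<bar> ^ N"
    if "0 \<le> v \<and> v \<le> L \<or> L \<le> v \<and> v \<le> 0" for v
    using that
  proof
    assume v: "0 \<le> v \<and> v \<le> L"
    \<comment> \<open>For \<open>v \<ge> 0\<close> the factor \<open>exp (- v y)\<close> works
      against monotonicity; in this form growth is visible because \<open>y \<le> N\<close>. For
      \<open>v \<le> 0\<close> both original factors grow as \<open>v\<close> decreases, because
      \<open>0 \<le> y\<close>.\<close>
    have eq: "exp (- (u * y)) * \<bar>1 - exp u\<bar> ^ N = exp (u * (real N - y)) * (1 - exp (- u)) ^ N" if "0 \<le> u" for u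
    proof -
      have "\<bar>1 - exp u\<bar> = exp u * (1 - exp (- u))"
        using that by (simp add: algebra_simps flip: exp_add)
      then have "\<bar>1 - exp u\<bar> ^ N = exp (u * real N) * (1 - exp (- u)) ^ N"
        by (simp add: power_mult_distrib mult_ac flip: exp_of_nat_mult)
      then show ?thesis by (simp add: algebra_simps flip: exp_add)
    qed
    have "v * (real N - y) \<le> L * (real N - y)" using v y by (simp add: mult_right_mono)
    then show ?thesis using v unfolding eq[OF conjunct1[OF v]] using eq[of L]
      by (auto intro!: mult_mono power_mono)
  next
    assume v: "L \<le> v \<and> v \<le> 0"
    then have "L * y \<le> v * y" using y by (simp add: mult_right_mono)
    then show ?thesis using v by (intro mult_mono power_mono) auto
  qed
  have "norm (?h L - ?h 0) \<le> (exp (- (L * y)) * \<bar>1 - exp L\<bar> ^ N) * norm (L - 0)"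
  proof (rule field_differentiable_bound[where S = "closed_segment 0 L" and f' = "\<lambda>v. - (exp (- (v * y)) * (1 - exp v) ^ N)"])
    fix v assume "v \<in> closed_segment 0 L"
    then have v: "0 \<le> v \<and> v \<le> L \<or> L \<le> v \<and> v \<le> 0"
      by (auto simp: closed_segment_eq_real_ivl split: if_splits)
    show "(?h has_field_derivative - (exp (- (v * y)) * (1 - exp v) ^ N)) (at v within closed_segment 0 L)"
      using D by (rule has_field_derivative_at_within)
    show "norm (- (exp (- (v * y)) * (1 - exp v) ^ N)) \<le> exp (- (L * y)) * \<bar>1 - exp L\<bar> ^ N"
      using bound[OF v] by (simp add: abs_mult power_abs)
  qed auto
  then show ?thesis by (simp add: mult_ac)
qed

text \<open>The two sides agree at integers. Off the integers both are \<open>sin (\<pi> y)\<close> times a sum of simple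
  fractions, and the difference is an integral over the branch cut between \<open>- 1\<close> and \<open>- p / (1 - p)\<close>.\<close>

lemma weight_char_integral_bound:
  assumes p: "0 < p" "p < 1" and y: "0 \<le> y" "y \<le> real N"
  shows "norm (of_real (weight p N y) - char_integral p N y) \<le> \<bar>ln (p / (1 - p))\<bar> * \<bar>1 - 2 * p\<bar> ^ N"
proof (cases "y \<in> \<int>")
  case True
  then obtain m where "y = real_of_int m" by (auto elim: Ints_cases)
  then have "y = real (nat m)" "nat m \<le> N" using y by auto
  then show ?thesis using char_integral_of_nat[OF p, of "nat m" N] by simp
next
  case False
  define q where "q = 1 - p"
  \<comment> \<open>\<open>p^j q^(N - j)\<close> equals \<open>q^N exp (L j)\<close>. After
    \<open>p^y q^(N - y)\<close> is taken out, the Fourier coefficient has an extra factor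
    \<open>exp (L (j - y))\<close> in each simple fraction, so its difference from the weight is the
    sum of \<open>alternating_binomial_exp_bound\<close>.\<close>
  define L where "L = ln (p / q)"
  have q: "0 < q" using p by (simp add: q_def)
  have eL: "exp L = p / q" using p q by (simp add: L_def)
  have nz: "y \<noteq> real j" for j using False by auto
  have wt: "p powr y * q powr (real N - y) = q ^ N * exp (L * y)"
  proof -
    have "exp (L * y) = (p / q) powr y" using p q by (simp add: powr_def L_def mult.commute)
    then show ?thesis using p q by (simp add: powr_diff powr_realpow powr_divide)
  qed
  have pj: "p ^ j * q ^ (N - j) = q ^ N * exp (L * y) * exp (L * (real j - y))" if "j \<le> N" for j
  proof -
    have "exp (L * y) * exp (L * (real j - y)) = exp L ^ j"
      by (simp add: algebra_simps flip: exp_add exp_of_nat_mult)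
    moreover have "q ^ N = q ^ j * q ^ (N - j)" using that by (simp flip: power_add)
    ultimately show ?thesis using q by (simp add: eL power_divide)
  qed
  have sj: "sin (pi * (real j - y)) / (pi * (real j - y)) = sin (pi * y) / pi * ((- 1) ^ j / (y - real j))" for j
  proof -
    have "sin (pi * (real j - y)) = - ((- 1) ^ j * sin (pi * y))"
      by (simp add: sin_diff right_diff_distrib)
    then show ?thesis using nz[of j] by (simp add: field_simps)
  qed
  let ?S = "\<Sum>j\<le>N. real (N choose j) * ((- 1) ^ j / (y - real j)) * (exp (L * (real j - y)) - 1)"
  have "char_integral p N y = of_real (\<Sum>j\<le>N. sin (pi * y) / pi * (q ^ N * exp (L * y)) *
      (real (N choose j) * ((- 1) ^ j / (y - real j)) * exp (L * (real j - y))))"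
    unfolding char_integral_conv_sum q_def[symmetric]
  proof (intro arg_cong[where f = of_real] sum.cong refl)
    fix j assume "j \<in> {..N}"
    then have pj': "p ^ j * q ^ (N - j) = q ^ N * exp (L * y) * exp (L * (real j - y))" using pj by simp
    have "real (N choose j) * p ^ j * q ^ (N - j) *
        (if y = real j then 1 else sin (pi * (real j - y)) / (pi * (real j - y)))
      = real (N choose j) * (p ^ j * q ^ (N - j)) * (sin (pi * y) / pi * ((- 1) ^ j / (y - real j)))"
      using nz[of j] sj[of j] by simp
    then show "real (N choose j) * p ^ j * q ^ (N - j) *
        (if y = real j then 1 else sin (pi * (real j - y)) / (pi * (real j - y)))
      = sin (pi * y) / pi * (q ^ N * exp (L * y)) *
      (real (N choose j) * ((- 1) ^ j / (y - real j)) * exp (L * (real j - y)))"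
      unfolding pj' by (simp only: mult_ac)
  qed
  moreover have "weight p N y = (\<Sum>j\<le>N. sin (pi * y) / pi * (q ^ N * exp (L * y)) *
      (real (N choose j) * ((- 1) ^ j / (y - real j))))"
  proof -
    have "weight p N y = (p powr y * q powr (real N - y)) * (fact N / (Gamma (1 + y) * Gamma (real N + 1 - y)))"
      by (simp add: weight_def q_def)
    then show ?thesis
      unfolding wt binomial_Gamma_sinc_series[OF False] by (simp add: sum_distrib_left mult_ac)
  qed
  ultimately have "of_real (weight p N y) - char_integral p N y
      = of_real (- (sin (pi * y) / pi * (q ^ N * exp (L * y)) * ?S))"
    by (simp only: of_real_diff[symmetric] sum_subtractf[symmetric] sum_distrib_left sum_negf[symmetric] right_diff_distrib mult_1_right minus_diff_eq)
  then have "norm (of_real (weight p N y) - char_integral p N y) = \<bar>sin (pi * y)\<bar> / pi * (q ^ N * exp (L * y)) * \<bar>?S\<bar>"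
    using q by (simp only: norm_of_real abs_minus_cancel abs_mult) simp
  also have "\<dots> \<le> 1 * (q ^ N * exp (L * y)) * (\<bar>L\<bar> * (exp (- (L * y)) * \<bar>1 - exp L\<bar> ^ N))"
  proof (intro mult_mono alternating_binomial_exp_bound y False)
    have "\<bar>sin (pi * y)\<bar> \<le> pi" using pi_gt3 abs_sin_le_one[of "pi * y"] by linarith
    then show "\<bar>sin (pi * y)\<bar> / pi \<le> 1" by (simp add: divide_le_eq)
  qed (use q in auto)
  also have "\<dots> = \<bar>L\<bar> * (q * \<bar>1 - exp L\<bar>) ^ N"
    by (simp add: power_mult_distrib exp_minus)
  \<comment> \<open>The rate is \<open>\<bar>q - p\<bar>\<close>, which is less than
    \<open>1\<close> for \<open>0 < p < 1\<close>.\<close>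
  also have "q * \<bar>1 - exp L\<bar> = \<bar>1 - 2 * p\<bar>"
  proof -
    have "q * \<bar>1 - exp L\<bar> = \<bar>q * (1 - exp L)\<bar>" using q by (simp add: abs_mult)
    also have "q * (1 - exp L) = 1 - 2 * p" using q unfolding right_diff_distrib eL by (simp add: q_def)
    finally show ?thesis .
  qed
  finally show ?thesis by (simp add: L_def q_def)
qed

text \<open>Shifts of \<open>y\<close> multiply the integrand by powers of
  \<open>exp (- \<i> t)\<close>, whose alternating binomial sum is the inserted \<open>s\<close>-th
  power. The errors add up with the binomial coefficients as weights, hence the factor
  \<open>2^s\<close>.\<close>

lemma fwd_diff_weight_char_integral_bound:
  assumes p: "0 < p" "p < 1" and y: "0 \<le> y" "y + real s \<le> real N"
  shows "norm (of_real ((fwd_diff ^^ s) (weight p N) y) -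
     (LINT t|lborel. indicator {- pi..pi} t *\<^sub>R
     (exp (- (\<i> * of_real (y * t))) * (of_real (1 - p) + of_real p * exp (\<i> * of_real t)) ^ N *
      (exp (- (\<i> * of_real t)) - 1) ^ s)) / of_real (2 * pi))
     \<le> 2 ^ s * \<bar>ln (p / (1 - p))\<bar> * \<bar>1 - 2 * p\<bar> ^ N" (is "norm (_ - ?I) \<le> _")
proof -
  let ?f = "\<lambda>y t. indicator {- pi..pi} t *\<^sub>R
     (exp (- (\<i> * complex_of_real (y * t))) * (of_real (1 - p) + of_real p * exp (\<i> * of_real t)) ^ N)"
  have "continuous_on {- pi..pi} (\<lambda>t. exp (- (\<i> * complex_of_real (z * t))) * (of_real (1 - p) + of_real p * exp (\<i> * of_real t)) ^ N)" for z
    by (intro continuous_intros)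
  then have int: "integrable lborel (?f z)" for z
    using borel_integrable_atLeastAtMost' unfolding set_integrable_def by blast
  have "?I = (LINT t|lborel. (\<Sum>l\<le>s. of_real (real (s choose l) * (- 1) ^ (s - l)) * ?f (y + real l) t)) / of_real (2 * pi)"
  proof (intro arg_cong2[where f = "(/)"] Bochner_Integration.integral_cong refl)
    fix t
    have "(exp (- (\<i> * of_real t)) - 1) ^ s
      = (\<Sum>l\<le>s. of_real (real (s choose l) * (- 1) ^ (s - l)) * exp (- (\<i> * of_real t)) ^ l)"
      using binomial_ring[of "exp (- (\<i> * of_real t))" "- 1" s] by (simp add: mult_ac)
    moreover have ee: "exp (- (\<i> * of_real (y * t))) * exp (- (\<i> * of_real t)) ^ l = exp (- (\<i> * of_real ((y + real l) * t)))" for l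
      by (simp add: algebra_simps flip: exp_of_nat_mult exp_add)
    ultimately show "indicator {- pi..pi} t *\<^sub>R
      (exp (- (\<i> * of_real (y * t))) * (of_real (1 - p) + of_real p * exp (\<i> * of_real t)) ^ N *
      (exp (- (\<i> * of_real t)) - 1) ^ s) = (\<Sum>l\<le>s. of_real (real (s choose l) * (- 1) ^ (s - l)) * ?f (y + real l) t)"
      by (simp only: sum_distrib_left sum_distrib_right scaleR_sum_right ee[symmetric]) (simp add: mult_ac)
  qed
  also have "\<dots> = (\<Sum>l\<le>s. of_real (real (s choose l) * (- 1) ^ (s - l)) * char_integral p N (y + real l))"
    by (subst integral_sum_mult_left[OF int]) (simp only: char_integral_def sum_divide_distrib times_divide_eq_right)
  finally have I: "?I = \<dots>" .
  have "of_real ((fwd_diff ^^ s) (weight p N) y) - ?I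
     = (\<Sum>l\<le>s. of_real (real (s choose l) * (- 1) ^ (s - l)) * (of_real (weight p N (y + real l)) - char_integral p N (y + real l)))"
    unfolding I fwd_diff_funpow by (simp add: sum_subtractf[symmetric] right_diff_distrib mult.assoc)
  also have "norm \<dots> \<le> (\<Sum>l\<le>s. real (s choose l) * (\<bar>ln (p / (1 - p))\<bar> * \<bar>1 - 2 * p\<bar> ^ N))"
  proof (rule sum_norm_le)
    fix l assume "l \<in> {..s}"
    then have "norm (of_real (weight p N (y + real l)) - char_integral p N (y + real l)) \<le> \<bar>ln (p / (1 - p))\<bar> * \<bar>1 - 2 * p\<bar> ^ N"
      using y by (intro weight_char_integral_bound p) auto
    then show "norm (of_real (real (s choose l) * (- 1) ^ (s - l)) * (of_real (weight p N (y + real l)) - char_integral p N (y + real l)))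
      \<le> real (s choose l) * (\<bar>ln (p / (1 - p))\<bar> * \<bar>1 - 2 * p\<bar> ^ N)"
      by (simp add: norm_mult norm_power mult_left_mono)
  qed
  also have "\<dots> = 2 ^ s * \<bar>ln (p / (1 - p))\<bar> * \<bar>1 - 2 * p\<bar> ^ N"
    using choose_row_sum[of s] by (simp flip: sum_distrib_right of_nat_sum of_nat_power add: mult.assoc)
  finally show ?thesis .
qed

section \<open>The cumulant generating function\<close>

text \<open>Bridges the iterated real derivatives that define cumulants and the Taylor coefficients
  of a holomorphic function. Along the real axis each complex derivative is the derivative of a
  real-valued curve, so its imaginary part vanishes.\<close>

lemma higher_deriv_of_real:
  fixes f :: "complex \<Rightarrow> complex" and g :: "real \<Rightarrow> real"
  assumes f: "f holomorphic_on S" and S: "open S"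
    and eq: "\<And>t. of_real t \<in> S \<Longrightarrow> f (of_real t) = of_real (g t)" and t: "of_real t \<in> S"
  shows "(deriv ^^ n) f (of_real t) = of_real ((deriv ^^ n) g t)"
  using t
proof (induction n arbitrary: t)
  case (Suc n)
  let ?D = "deriv ((deriv ^^ n) f) (of_real t)"
  have "(deriv ^^ n) f holomorphic_on S" by (rule holomorphic_higher_deriv[OF f S])
  then have "((deriv ^^ n) f has_field_derivative ?D) (at (of_real t))"
    using S Suc.prems by (rule holomorphic_derivI)
  then have "((\<lambda>x. (deriv ^^ n) f (of_real x)) has_vector_derivative ?D) (at t)"
    by (rule has_vector_derivative_real_field)
  moreover have "open ((of_real :: real \<Rightarrow> complex) -` S)"
    by (intro open_vimage S) (auto intro: continuous_intros)
  ultimately have D: "((\<lambda>x. complex_of_real ((deriv ^^ n) g x)) has_vector_derivative ?D) (at t)"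
  proof (rule has_vector_derivative_transform_within_open)
    show "t \<in> of_real -` S" using Suc.prems by simp
  qed (use Suc.IH in auto)
  have "((\<lambda>x. Re (complex_of_real ((deriv ^^ n) g x))) has_vector_derivative Re ?D) (at t)"
    using D by (rule bounded_linear.has_vector_derivative[OF bounded_linear_Re])
  then have "deriv ((deriv ^^ n) g) t = Re ?D"
    by (auto intro!: DERIV_imp_deriv simp: has_real_derivative_iff_has_vector_derivative)
  moreover have "((\<lambda>x. Im (complex_of_real ((deriv ^^ n) g x))) has_vector_derivative Im ?D) (at t)"
    using D by (rule bounded_linear.has_vector_derivative[OF bounded_linear_Im])
  then have "((\<lambda>x. 0 :: real) has_vector_derivative Im ?D) (at t)" by simp
  then have "Im ?D = 0"
    using vector_derivative_at[of "\<lambda>x. 0 :: real" "Im ?D" t] by simp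
  ultimately show ?case by (simp add: complex_eq_iff)
qed (simp add: eq)

text \<open>Cauchy's inequality on the circle of radius \<open>d\<close>, then a geometric series of
  ratio at most \<open>1 / 2\<close>. The function enters only through \<open>B\<close>, which makes
  the bounds uniform in a parameter: later \<open>B\<close> grows exponentially in
  \<open>N t^2\<close> while \<open>d\<close> stays fixed.\<close>

lemma taylor_polynomial_bounds:
  fixes f :: "complex \<Rightarrow> complex"
  assumes f: "f holomorphic_on ball 0 r" and d: "0 < d" "d < r"
    and B: "\<And>z. norm z \<le> d \<Longrightarrow> norm (f z) \<le> B"
  shows norm_taylor_coeff_le: "norm ((deriv ^^ n) f 0 / fact n) \<le> B / d ^ n"
    and norm_taylor_remainder_le: "norm w \<le> d / 2 \<Longrightarrow>
      norm (f w - (\<Sum>n<m. (deriv ^^ n) f 0 / fact n * w ^ n)) \<le> 2 * B * (norm w / d) ^ m"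
proof -
  have cont: "continuous_on (cball 0 d) f" "f holomorphic_on ball 0 d"
    using f d by (auto intro!: holomorphic_on_imp_continuous_on elim!: holomorphic_on_subset)
  have coeff: "norm ((deriv ^^ n) f 0 / fact n) \<le> B / d ^ n" for n
  proof -
    have "norm ((deriv ^^ n) f 0) \<le> fact n * B / d ^ n"
      using B cont d by (intro Cauchy_inequality) auto
    then show ?thesis by (simp add: norm_divide field_simps)
  qed
  then show "norm ((deriv ^^ n) f 0 / fact n) \<le> B / d ^ n" .
  have B0: "0 \<le> B" using B[of 0] d by (auto intro: order.trans[OF norm_ge_zero])
  assume w: "norm w \<le> d / 2"
  define c where "c n = (deriv ^^ n) f 0 / fact n * w ^ n" for n
  define x where "x = norm w / d"
  have x: "0 \<le> x" "x \<le> 1 / 2" using w d by (auto simp: x_def field_simps)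
  have "w \<in> ball 0 r" using w d by simp
  then have sums: "c sums f w"
    using holomorphic_power_series[OF f, of w] by (simp add: c_def[abs_def])
  have cb: "norm (c n) \<le> B * x ^ n" for n
    using mult_right_mono[OF coeff[of n], of "norm w ^ n"]
    by (simp add: c_def norm_mult norm_divide norm_power x_def power_divide)
  have gs: "(\<lambda>n. B * x ^ m * x ^ n) sums (B * x ^ m * (1 / (1 - x)))"
    using x by (intro sums_mult geometric_sums) auto
  have "f w - (\<Sum>n<m. c n) = (\<Sum>n. c (n + m))"
    using suminf_minus_initial_segment[of c m] sums by (simp add: sums_iff)
  also have "norm \<dots> \<le> (\<Sum>n. B * x ^ m * x ^ n)"
    using gs cb[of "_ + m"] by (intro norm_suminf_le) (auto simp: sums_iff power_add mult_ac)
  also have "\<dots> = B * x ^ m * (1 / (1 - x))" using gs by (simp add: sums_iff)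
  also have "\<dots> \<le> B * x ^ m * 2"
    using x B0 by (intro mult_left_mono) (auto simp: field_simps)
  finally show "norm (f w - (\<Sum>n<m. (deriv ^^ n) f 0 / fact n * w ^ n)) \<le> 2 * B * (norm w / d) ^ m"
    by (simp add: c_def x_def mult_ac)
qed

section \<open>The logarithm of the moment generating function near \<open>0\<close>\<close>

definition log_mgf :: "real \<Rightarrow> complex \<Rightarrow> complex" where
  "log_mgf p w = Ln (of_real (1 - p) + of_real p * exp w)"

definition cumulant_fps :: "real \<Rightarrow> complex fps" where
  "cumulant_fps p = fps_expansion (log_mgf p) 0"

text \<open>Around \<open>0\<close> one has \<open>log_mgf p w = p w + w^2 (p (1 - p) / 2 + excess w)\<close>, where
  \<open>excess\<close> is the sum of the following series.\<close>

definition excess_fps :: "real \<Rightarrow> complex fps" where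
  "excess_fps p = fps_shift 2 (cumulant_fps p) - fps_const (of_real (p * (1 - p) / 2))"

context
  fixes p :: real
  assumes p: "0 < p" "p < 1"
begin

text \<open>For \<open>norm w < 1 < \<pi> / 2\<close> the exponential has positive real part. This
  keeps the generating function off the branch cut of \<open>Ln\<close>, so the unit disc can serve
  as the common domain below.\<close>

lemma mgf_Re_pos:
  fixes w :: complex
  assumes "norm w < 1"
  shows "Re (of_real (1 - p) + of_real p * exp w) > 0"
proof -
  have "\<bar>Im w\<bar> < pi / 2" using assms abs_Im_le_cmod[of w] pi_gt3 by linarith
  then have "cos (Im w) > 0" by (intro cos_gt_zero_pi) auto
  then have "Re (of_real p * exp w) > 0" using p by (simp add: Re_exp)
  then show ?thesis using p by simp
qed

lemma mgf_nonpos: "norm w < 1 \<Longrightarrow> of_real (1 - p) + of_real p * exp w \<notin> \<real>\<^sub>\<le>\<^sub>0" for w :: complex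
  using mgf_Re_pos[of w] by (auto simp: complex_nonpos_Reals_iff)

lemma exp_log_mgf: "norm w < 1 \<Longrightarrow> exp (log_mgf p w) = of_real (1 - p) + of_real p * exp w"
  unfolding log_mgf_def by (rule exp_Ln) (metis mgf_nonpos nonpos_Reals_zero_I)

lemma has_field_derivative_log_mgf:
  assumes "norm w < 1"
  shows "(log_mgf p has_field_derivative of_real p * exp w / (of_real (1 - p) + of_real p * exp w)) (at w)"
  unfolding log_mgf_def using mgf_nonpos[OF assms]
  by (auto intro!: derivative_eq_intros simp: field_simps)

lemma holomorphic_log_mgf: "log_mgf p holomorphic_on ball 0 1"
  unfolding holomorphic_on_open[OF open_ball]
  by (intro ballI exI) (rule has_field_derivative_log_mgf, simp)

lemma conv_radius_cumulant_fps: "fps_conv_radius (cumulant_fps p) \<ge> 1"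
  unfolding cumulant_fps_def using holomorphic_log_mgf
  by (intro conv_radius_fps_expansion) (simp add: one_ereal_def)

lemma eval_cumulant_fps:
  assumes "norm w < 1"
  shows "eval_fps (cumulant_fps p) w = log_mgf p w"
  using eval_fps_expansion'[of "log_mgf p" 0 1 w] holomorphic_log_mgf assms
  by (simp add: cumulant_fps_def one_ereal_def)

lemma cumulant_fps_0 [simp]: "fps_nth (cumulant_fps p) 0 = 0"
  by (simp add: cumulant_fps_def fps_expansion_def log_mgf_def)

lemma cumulant_fps_1 [simp]: "fps_nth (cumulant_fps p) (Suc 0) = of_real p"
  using DERIV_imp_deriv[OF has_field_derivative_log_mgf[of 0]] by (simp add: cumulant_fps_def fps_expansion_def)

lemma cumulant_fps_2 [simp]: "fps_nth (cumulant_fps p) 2 = of_real (p * (1 - p) / 2)"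
proof -
  have "eventually (\<lambda>w::complex. w \<in> ball 0 1) (nhds 0)"
    by (intro eventually_nhds_in_open) auto
  then have "eventually (\<lambda>w. deriv (log_mgf p) w = of_real p * exp w / (of_real (1 - p) + of_real p * exp w)) (nhds 0)"
    by eventually_elim (intro DERIV_imp_deriv has_field_derivative_log_mgf, simp)
  then have "deriv (deriv (log_mgf p)) 0 = deriv (\<lambda>w. of_real p * exp w / (of_real (1 - p) + of_real p * exp w)) 0"
    by (intro deriv_cong_ev) auto
  also have "\<dots> = of_real (p * (1 - p))"
    by (rule DERIV_imp_deriv) (auto intro!: derivative_eq_intros simp: algebra_simps)
  finally show ?thesis by (simp add: cumulant_fps_def fps_expansion_def numeral_2_eq_2)
qed

lemma cumulant_fps_nth: "fps_nth (cumulant_fps p) i = of_real (bernoulli_cumulant p i / fact i)"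
proof -
  have "(deriv ^^ i) (log_mgf p) (of_real 0)
    = of_real ((deriv ^^ i) (\<lambda>t. ln (measure_pmf.expectation (map_pmf of_bool (bernoulli_pmf p)) (\<lambda>x. exp (t * x)))) 0)"
  proof (rule higher_deriv_of_real[OF holomorphic_log_mgf])
    fix t :: real
    have "(1 - p) + p * exp t > 0" using p by (intro add_pos_pos) auto
    then have "Ln (complex_of_real ((1 - p) + p * exp t)) = of_real (ln ((1 - p) + p * exp t))"
      by (rule Ln_of_real)
    then show "log_mgf p (of_real t) = of_real (ln (measure_pmf.expectation (map_pmf of_bool (bernoulli_pmf p)) (\<lambda>x. exp (t * x))))"
      using p by (simp add: log_mgf_def exp_of_real[symmetric] add.commute mult.commute)
  qed auto
  then show ?thesis
    by (simp add: cumulant_fps_def fps_expansion_def bernoulli_cumulant_def cumulant_def)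
qed

lemma excess_fps_0 [simp]: "fps_nth (excess_fps p) 0 = 0"
  using cumulant_fps_2 by (simp add: excess_fps_def numeral_2_eq_2)

lemma excess_fps_nth:
  "m > 0 \<Longrightarrow> fps_nth (excess_fps p) m = of_real (bernoulli_cumulant p (m + 2) / fact (m + 2))"
  by (simp add: excess_fps_def cumulant_fps_nth)

lemma conv_radius_excess_fps: "fps_conv_radius (excess_fps p) \<ge> 1"
proof -
  have "min (fps_conv_radius (fps_shift 2 (cumulant_fps p))) \<infinity> \<le> fps_conv_radius (excess_fps p)"
    unfolding excess_fps_def by (rule order.trans[OF _ fps_conv_radius_diff]) simp
  then show ?thesis using conv_radius_cumulant_fps by (simp add: min_def split: if_splits)
qed

lemma less_conv_radius_excess_fps: "norm w < 1 \<Longrightarrow> ereal (norm w) < fps_conv_radius (excess_fps p)"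
  by (rule less_le_trans[OF _ conv_radius_excess_fps]) (simp add: one_ereal_def)

lemma holomorphic_excess: "eval_fps (excess_fps p) holomorphic_on ball 0 1"
  by (intro holomorphic_on_eval_fps) (auto simp: in_eball_iff less_conv_radius_excess_fps)

lemma log_mgf_expansion:
  assumes "norm w < 1"
  shows "log_mgf p w = of_real p * w + w ^ 2 * (of_real (p * (1 - p) / 2) + eval_fps (excess_fps p) w)"
proof -
  have "cumulant_fps p = fps_const (of_real p) * fps_X + fps_X ^ 2 * (fps_const (of_real (p * (1 - p) / 2)) + excess_fps p)"
  proof (rule fps_ext)
    fix n
    consider "n = 0" | "n = 1" | m where "n = Suc (Suc m)"
      by (metis One_nat_def not0_implies_Suc)
    moreover have two: "fps_nth (cumulant_fps p) (Suc (Suc 0)) * 2 = of_real p * (1 - of_real p)"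
      using cumulant_fps_2 by (simp add: numeral_2_eq_2)
    ultimately show "fps_nth (cumulant_fps p) n = fps_nth (fps_const (of_real p) * fps_X + fps_X ^ 2 * (fps_const (of_real (p * (1 - p) / 2)) + excess_fps p)) n"
      by cases (simp_all add: excess_fps_def fps_X_power_mult_nth two)
  qed
  then have "log_mgf p w = eval_fps (fps_const (of_real p) * fps_X + fps_X ^ 2 * (fps_const (of_real (p * (1 - p) / 2)) + excess_fps p)) w"
    using eval_cumulant_fps[OF assms] by simp
  moreover have r1: "ereal (norm w) < fps_conv_radius (fps_const (of_real (p * (1 - p) / 2)) + excess_fps p)"
    using less_conv_radius_excess_fps[OF assms]
    by (intro less_le_trans[OF _ fps_conv_radius_add]) auto
  moreover have "ereal (norm w) < fps_conv_radius (fps_const (complex_of_real p) * fps_X)"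
    by (intro less_le_trans[OF _ fps_conv_radius_mult]) auto
  moreover have "ereal (norm w) < fps_conv_radius (fps_X ^ 2 * (fps_const (of_real (p * (1 - p) / 2)) + excess_fps p))"
    using r1 by (intro less_le_trans[OF _ fps_conv_radius_mult]) auto
  ultimately show ?thesis
    using less_conv_radius_excess_fps[OF assms] by (simp add: eval_fps_add eval_fps_mult)
qed

text \<open>At \<open>w = \<i> t\<close> the centring factor cancels the linear term of
  \<open>log_mgf_expansion\<close>, and \<open>w^2 = - t^2\<close>. The variance term becomes the
  Gaussian, and the rest is \<open>exp (z E(w))\<close> with \<open>z = - N t^2\<close>.\<close>

lemma mgf_power_eq:
  assumes "\<bar>t\<bar> < 1"
  shows "(of_real (1 - p) + of_real p * exp (\<i> * of_real t)) ^ N * exp (- (\<i> * of_real (real N * p * t)))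
       = of_real (exp (- (real N * (p * (1 - p)) * t\<^sup>2 / 2))) *
         exp (- (of_real (real N * t\<^sup>2) * eval_fps (excess_fps p) (\<i> * of_real t)))"
proof -
  let ?w = "\<i> * complex_of_real t"
  have w: "norm ?w < 1" using assms by (simp add: norm_mult)
  have "(of_real (1 - p) + of_real p * exp ?w) ^ N = exp (of_nat N * log_mgf p ?w)"
    unfolding exp_log_mgf[OF w, symmetric] by (simp add: exp_of_nat_mult)
  also have "\<dots> * exp (- (\<i> * of_real (real N * p * t)))
     = exp (- of_real (real N * (p * (1 - p)) * t\<^sup>2 / 2) +
         (- (of_real (real N * t\<^sup>2) * eval_fps (excess_fps p) ?w)))"
    unfolding exp_add[symmetric] log_mgf_expansion[OF w]
    by (rule arg_cong[where f = exp]) (simp add: power_mult_distrib field_simps)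
  finally show ?thesis unfolding exp_add by (simp flip: exp_of_real)
qed

text \<open>A cruder Gaussian bound that reaches up to \<open>\<pi>\<close>, beyond the range of the
  expansion around \<open>0\<close>.\<close>

lemma norm_mgf_power_le:
  assumes "\<bar>t\<bar> \<le> pi"
  shows "norm ((of_real (1 - p) + of_real p * exp (\<i> * complex_of_real t)) ^ N) \<le> exp (- (real N * (p * (1 - p)) * t\<^sup>2 / 12))"
proof -
  let ?z = "of_real (1 - p) + of_real p * exp (\<i> * complex_of_real t)"
  \<comment> \<open>The cubic Taylor polynomial of \<open>exp (\<i> t)\<close> gives
    \<open>1 - cos t \<ge> t^2 / 2 - t^4 / 24\<close>, and \<open>t^2 \<le> \<pi>^2 \<le> 10\<close>
    leaves the constant \<open>1 / 2 - 10 / 24 = 1 / 12\<close>.\<close>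
  have cos: "1 - cos t \<ge> t\<^sup>2 / 12"
  proof -
    have "\<bar>cos t - (1 - t\<^sup>2 / 2)\<bar> \<le> \<bar>Re (exp (\<i> * of_real t) - (\<Sum>k\<le>3. (\<i> * of_real t) ^ k / fact k))\<bar>"
      by (simp add: numeral_3_eq_3 fact_numeral power2_eq_square Re_exp)
    also have "\<dots> \<le> \<bar>t\<bar> ^ Suc 3 / fact (Suc 3)"
      by (rule order.trans[OF abs_Re_le_cmod iexp_approx1])
    also have "\<dots> = t\<^sup>2 * t\<^sup>2 / 24"
      by (simp add: fact_numeral power2_eq_square eval_nat_numeral)
    also have "\<dots> \<le> 10 * t\<^sup>2 / 24"
    proof -
      have "t\<^sup>2 \<le> pi\<^sup>2" using power_mono[OF assms, of 2] by simp
      also have "pi\<^sup>2 \<le> (3.15)\<^sup>2" using pi_approx by (intro power_mono) auto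
      finally show ?thesis by (intro divide_right_mono mult_right_mono) (auto simp: power2_eq_square)
    qed
    finally show ?thesis using abs_ge_self[of "cos t - (1 - t\<^sup>2 / 2)"] by linarith
  qed
  have "(norm ?z)\<^sup>2 = 1 - 2 * (p * (1 - p)) * (1 - cos t)"
  proof -
    have "(norm ?z)\<^sup>2 = (1 - p + p * cos t)\<^sup>2 + (p * sin t)\<^sup>2"
      by (simp add: cmod_power2 Re_exp Im_exp)
    also have "\<dots> = 1 - 2 * (p * (1 - p)) * (1 - cos t)"
      using sin_cos_squared_add[of t] by (simp add: power_mult_distrib sin_squared_eq) (simp add: power2_eq_square algebra_simps)
    finally show ?thesis .
  qed
  also have "\<dots> \<le> 1 - 2 * (p * (1 - p)) * (t\<^sup>2 / 12)"
    using cos p by (intro diff_left_mono mult_left_mono) auto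
  also have "\<dots> \<le> exp (- (2 * (p * (1 - p)) * (t\<^sup>2 / 12)))"
    using exp_ge_add_one_self[of "- (2 * (p * (1 - p)) * (t\<^sup>2 / 12))"] by simp
  also have "\<dots> = (exp (- (p * (1 - p) * t\<^sup>2 / 12)))\<^sup>2"
    by (simp add: power2_eq_square flip: exp_add)
  finally have "norm ?z \<le> exp (- (p * (1 - p) * t\<^sup>2 / 12))"
    by (rule power2_le_imp_le) simp
  then have "norm ?z ^ N \<le> exp (- (p * (1 - p) * t\<^sup>2 / 12)) ^ N"
    by (rule power_mono) simp
  also have "\<dots> = exp (- (real N * (p * (1 - p)) * t\<^sup>2 / 12))"
    by (simp add: algebra_simps flip: exp_of_nat_mult)
  finally show ?thesis by (simp add: norm_power)
qed

end

text \<open>The parameter \<open>z\<close> stands for \<open>N w^2\<close>, which is kept fixed while expanding in \<open>w\<close>.\<close>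

definition edgeworth_fps :: "real \<Rightarrow> nat \<Rightarrow> complex \<Rightarrow> complex fps" where
  "edgeworth_fps p s z = (fps_exp (- 1) - 1) ^ s * (fps_exp z oo excess_fps p)"

section \<open>Comparison of the integrand with its truncated expansion\<close>

context
  fixes p :: real
  assumes p: "0 < p" "p < 1"
begin

lemma edgeworth_fps_expansion:
  "(\<lambda>w. (exp (- w) - 1) ^ s * exp (z * eval_fps (excess_fps p) w)) has_fps_expansion edgeworth_fps p s z"
proof -
  have "fps_conv_radius (excess_fps p) > 0"
    by (rule less_le_trans[OF _ conv_radius_excess_fps[OF p]]) simp
  then have E: "eval_fps (excess_fps p) has_fps_expansion excess_fps p"
    by (rule eval_fps_has_fps_expansion)
  have "((\<lambda>w. exp (z * w)) \<circ> eval_fps (excess_fps p)) has_fps_expansion (fps_exp z oo excess_fps p)"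
    by (intro has_fps_expansion_compose has_fps_expansion_exp E excess_fps_0 p)
  then show ?thesis
    unfolding edgeworth_fps_def o_def
    by (intro has_fps_expansion_mult has_fps_expansion_power has_fps_expansion_diff
        has_fps_expansion_1 has_fps_expansion_exp_neg1)
qed

text \<open>The radius \<open>d\<close> is chosen so that the excess stays below
  \<open>p (1 - p) / 4\<close>, half of the Gaussian exponent. At \<open>l = - N t^2\<close> the
  growth of the bounds is then absorbed by the Gaussian, with half of its exponent left over. The
  same \<open>d\<close> serves all \<open>s\<close>, \<open>l\<close>, \<open>n\<close> and
  \<open>m\<close>; the base \<open>4\<close> bounds \<open>norm (exp (- w) - 1)\<close> through
  \<open>exp 1 \<le> 3\<close>.\<close>

lemma edgeworth_fps_bounds:
  obtains d where "0 < d" "d < 1"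
    "\<And>s l n. norm (fps_nth (edgeworth_fps p s (of_real l)) n) \<le> 4 ^ s * exp (\<bar>l\<bar> * (p * (1 - p) / 4)) / d ^ n"
    "\<And>s l m w. norm w \<le> d / 2 \<Longrightarrow>
       norm ((exp (- w) - 1) ^ s * exp (of_real l * eval_fps (excess_fps p) w) -
             (\<Sum>n<m. fps_nth (edgeworth_fps p s (of_real l)) n * w ^ n))
         \<le> 2 * (4 ^ s * exp (\<bar>l\<bar> * (p * (1 - p) / 4))) * (norm w / d) ^ m"
proof -
  let ?E = "eval_fps (excess_fps p)"
  have "isCont ?E 0"
    using holomorphic_excess[OF p] holomorphic_on_imp_continuous_on
    by (intro continuous_on_interior[of "ball 0 1"]) auto
  moreover have "?E 0 = 0" by (simp add: eval_fps_at_0 p)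
  moreover have "0 < p * (1 - p) / 4" using p by simp
  ultimately obtain e where e: "e > 0" "\<And>w. norm w < e \<Longrightarrow> norm (?E w) < p * (1 - p) / 4"
    unfolding continuous_at_eps_delta by (metis diff_zero dist_norm)
  define d where "d = min (e / 2) (1 / 2)"
  have d: "0 < d" "d < 1" "d < e" using e by (auto simp: d_def)
  define f where "f s l w = (exp (- w) - 1) ^ s * exp (of_real l * ?E w)" for s l w
  have nth: "fps_nth (edgeworth_fps p s (of_real l)) n = (deriv ^^ n) (f s l) 0 / fact n" for s l n
    unfolding f_def by (rule fps_nth_fps_expansion[OF edgeworth_fps_expansion])
  have hol: "f s l holomorphic_on ball 0 1" for s l
    unfolding f_def by (intro holomorphic_intros holomorphic_excess p)
  have B: "norm (f s l w) \<le> 4 ^ s * exp (\<bar>l\<bar> * (p * (1 - p) / 4))" if "norm w \<le> d" for s l w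
  proof -
    have "norm (exp (- w)) \<le> exp 1"
      using that d abs_Re_le_cmod[of w] by (simp add: norm_exp_eq_Re)
    then have "norm (exp (- w) - 1) \<le> 4"
      using exp_le norm_triangle_ineq4[of "exp (- w)" 1] unfolding norm_one by linarith
    then have 1: "norm ((exp (- w) - 1) ^ s) \<le> 4 ^ s"
      by (simp add: norm_power power_mono)
    have "Re (of_real l * ?E w) \<le> norm (of_real l * ?E w)" by (rule complex_Re_le_cmod)
    also have "\<dots> \<le> \<bar>l\<bar> * (p * (1 - p) / 4)"
      using e(2)[of w] that d by (simp add: norm_mult mult_left_mono del: times_divide_eq_right)
    finally have 2: "norm (exp (of_real l * ?E w)) \<le> exp (\<bar>l\<bar> * (p * (1 - p) / 4))"
      by (simp add: norm_exp_eq_Re)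
    show ?thesis unfolding f_def norm_mult using 1 2 by (intro mult_mono) auto
  qed
  show thesis
  proof (rule that[of d])
    show "0 < d" "d < 1" by fact+
    fix s :: nat and l :: real
    show "norm (fps_nth (edgeworth_fps p s (of_real l)) n) \<le> 4 ^ s * exp (\<bar>l\<bar> * (p * (1 - p) / 4)) / d ^ n" for n
      unfolding nth using hol d(1,2) B by (rule norm_taylor_coeff_le)
    show "norm ((exp (- w) - 1) ^ s * exp (of_real l * ?E w) - (\<Sum>n<m. fps_nth (edgeworth_fps p s (of_real l)) n * w ^ n))
         \<le> 2 * (4 ^ s * exp (\<bar>l\<bar> * (p * (1 - p) / 4))) * (norm w / d) ^ m" if "norm w \<le> d / 2" for m w
      unfolding nth f_def[of s l w, symmetric] by (rule norm_taylor_remainder_le[OF hol d(1,2) B that])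
  qed
qed

text \<open>For \<open>\<bar>t\<bar> \<le> d / 2\<close> this is the Taylor remainder. For larger
  \<open>t\<close> integrand and polynomial are bounded separately, and a factor
  \<open>(2 \<bar>t\<bar> / d)^m \<ge> 1\<close> brings their Gaussian bounds into the same form. As
  \<open>t\<close> ranges over the whole line, the integral over one period can be replaced by
  Gaussian integrals.\<close>

lemma char_integrand_bound:
  obtains C c where "0 < c" "0 \<le> C"
    "\<And>N t. norm (indicator {- pi..pi} t *\<^sub>R
        ((of_real (1 - p) + of_real p * exp (\<i> * of_real t)) ^ N * exp (- (\<i> * of_real (real N * p * t))) *
         (exp (- (\<i> * of_real t)) - 1) ^ s)
       - of_real (exp (- (real N * (p * (1 - p)) * t\<^sup>2 / 2))) *
         (\<Sum>n<m. fps_nth (edgeworth_fps p s (of_real (- (real N * t\<^sup>2)))) n * (\<i> * of_real t) ^ n))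
       \<le> C * \<bar>t\<bar> ^ m * exp (- (c * real N * t\<^sup>2))"
proof -
  obtain d where d: "0 < d" "d < 1"
    and coeff: "\<And>s l n. norm (fps_nth (edgeworth_fps p s (of_real l)) n) \<le> 4 ^ s * exp (\<bar>l\<bar> * (p * (1 - p) / 4)) / d ^ n"
    and rem: "\<And>s l m w. norm w \<le> d / 2 \<Longrightarrow>
       norm ((exp (- w) - 1) ^ s * exp (of_real l * eval_fps (excess_fps p) w) -
             (\<Sum>n<m. fps_nth (edgeworth_fps p s (of_real l)) n * w ^ n))
         \<le> 2 * (4 ^ s * exp (\<bar>l\<bar> * (p * (1 - p) / 4))) * (norm w / d) ^ m"
    by (rule edgeworth_fps_bounds) (rule that)
  define v where "v = p * (1 - p)"
  have v: "0 < v" using p by (simp add: v_def)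
  \<comment> \<open>The summands account, in this order, for the Taylor remainder, the
    \<open>m\<close> terms of the polynomial and the integrand itself at large
    \<open>t\<close>.\<close>
  define C where "C = (2 * 4 ^ s + real m * 4 ^ s + 2 ^ s) * (2 / d) ^ m"
  \<comment> \<open>Near \<open>0\<close> the exponent \<open>v / 2 - v / 4\<close> is available,
    far away only \<open>v / 12\<close> from \<open>norm_mgf_power_le\<close>; both are weakened to
    the latter.\<close>
  have exp_mono: "exp (- (k * X)) \<le> exp (- (v / 12 * X))" if "X \<ge> 0" "k \<ge> v / 12" for k X :: real
    using mult_right_mono[of "v / 12" k X] that by simp
  show thesis
  proof (rule that[of "v / 12" C])
    show "0 < v / 12" "0 \<le> C" using v d by (auto simp: C_def)
    fix N :: nat and t :: real
    let ?X = "real N * t\<^sup>2"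
    let ?w = "\<i> * complex_of_real t"
    let ?J = "indicator {- pi..pi} t *\<^sub>R
        ((of_real (1 - p) + of_real p * exp (\<i> * of_real t)) ^ N * exp (- (\<i> * of_real (real N * p * t))) *
         (exp (- (\<i> * of_real t)) - 1) ^ s)"
    let ?P = "\<Sum>n<m. fps_nth (edgeworth_fps p s (of_real (- ?X))) n * ?w ^ n"
    let ?g = "exp (- (real N * (p * (1 - p)) * t\<^sup>2 / 2))"
    have g: "?g * exp (\<bar>- ?X\<bar> * (p * (1 - p) / 4)) \<le> exp (- (v / 12 * ?X))"
    proof -
      have "?g * exp (\<bar>- ?X\<bar> * (p * (1 - p) / 4)) = exp (- (v / 4 * ?X))"
      proof -
        have "- (n * u * x / 2) + n * x * (u / 4) = - (u / 4 * (n * x))" for n u x :: real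
          by (simp add: field_simps)
        moreover have "\<bar>- ?X\<bar> = ?X" by simp
        ultimately show ?thesis by (simp only: exp_add[symmetric] v_def)
      qed
      also have "\<dots> \<le> exp (- (v / 12 * ?X))" using v by (intro exp_mono) auto
      finally show ?thesis .
    qed
    have "norm (?J - of_real ?g * ?P) \<le> C * \<bar>t\<bar> ^ m * exp (- (v / 12 * ?X))"
    proof (cases "\<bar>t\<bar> \<le> d / 2")
      case True
      then have t1: "\<bar>t\<bar> < 1" using d by simp
      then have ind: "t \<in> {- pi..pi}" using pi_gt3 by auto
      have J: "?J = of_real ?g * ((exp (- ?w) - 1) ^ s * exp (of_real (- ?X) * eval_fps (excess_fps p) ?w))"
        using mgf_power_eq[OF p t1, of N] ind by (simp add: mult_ac)
      have "norm (?J - of_real ?g * ?P) = ?g * norm ((exp (- ?w) - 1) ^ s * exp (of_real (- ?X) * eval_fps (excess_fps p) ?w) - ?P)"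
        unfolding J right_diff_distrib[symmetric] norm_mult norm_of_real by simp
      also have "\<dots> \<le> ?g * (2 * (4 ^ s * exp (\<bar>- ?X\<bar> * (p * (1 - p) / 4))) * (norm ?w / d) ^ m)"
        using True by (intro mult_left_mono rem) (auto simp: norm_mult)
      also have "\<dots> = 2 * 4 ^ s * (\<bar>t\<bar> / d) ^ m * (?g * exp (\<bar>- ?X\<bar> * (p * (1 - p) / 4)))"
        by (simp add: norm_mult mult_ac)
      also have "\<dots> \<le> 2 * 4 ^ s * (\<bar>t\<bar> / d) ^ m * exp (- (v / 12 * ?X))"
        using d g by (intro mult_left_mono) auto
      also have "\<dots> \<le> C * \<bar>t\<bar> ^ m * exp (- (v / 12 * ?X))"
      proof (rule mult_right_mono)
        have "2 * 4 ^ s * (\<bar>t\<bar> / d) ^ m = 2 * 4 ^ s * (1 / d) ^ m * \<bar>t\<bar> ^ m"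
          by (simp add: power_divide)
        also have "\<dots> \<le> C * \<bar>t\<bar> ^ m"
          unfolding C_def using d by (intro mult_right_mono mult_mono power_mono divide_right_mono) auto
        finally show "2 * 4 ^ s * (\<bar>t\<bar> / d) ^ m \<le> C * \<bar>t\<bar> ^ m" .
      qed auto
      finally show ?thesis .
    next
      case False
      define y where "y = 2 / d * \<bar>t\<bar>"
      have y: "1 \<le> y" using False d by (simp add: y_def field_simps)
      have "norm ?J \<le> exp (- (v / 12 * ?X)) * 2 ^ s"
      proof (cases "\<bar>t\<bar> \<le> pi")
        case True
        have "norm (exp (- ?w) - 1) \<le> 2"
          using norm_triangle_ineq4[of "exp (- ?w)" 1] by (simp add: norm_exp_eq_Re)
        then have "norm ((exp (- ?w) - 1) ^ s) \<le> 2 ^ s" by (simp add: norm_power power_mono)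
        moreover have "norm (exp (- (\<i> * complex_of_real (real N * p * t)))) = 1"
          by (simp add: norm_exp_eq_Re)
        moreover have "norm ((of_real (1 - p) + of_real p * exp (\<i> * of_real t)) ^ N) \<le> exp (- (v / 12 * ?X))"
          using norm_mgf_power_le[OF p True, of N] by (simp add: v_def mult_ac)
        moreover have "t \<in> {- pi..pi}" using True by auto
        ultimately show ?thesis
          unfolding norm_scaleR norm_mult by (simp add: mult_mono del: of_real_mult)
      next
        case False
        then have "indicator {- pi..pi} t = (0 :: real)" by (auto simp: indicator_def)
        then show ?thesis by simp
      qed
      also have "\<dots> \<le> exp (- (v / 12 * ?X)) * (2 ^ s * y ^ m)"
        using y by (intro mult_left_mono) auto
      finally have J: "norm ?J \<le> exp (- (v / 12 * ?X)) * (2 ^ s * y ^ m)" .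
      have "norm ?P \<le> (\<Sum>n<m. 4 ^ s * exp (\<bar>- ?X\<bar> * (p * (1 - p) / 4)) * y ^ m)"
      proof (rule sum_norm_le)
        fix n assume "n \<in> {..<m}"
        have "norm (fps_nth (edgeworth_fps p s (of_real (- ?X))) n * ?w ^ n)
          \<le> 4 ^ s * exp (\<bar>- ?X\<bar> * (p * (1 - p) / 4)) / d ^ n * \<bar>t\<bar> ^ n"
          using mult_right_mono[OF coeff[of s "- ?X" n], of "\<bar>t\<bar> ^ n"] by (simp add: norm_mult norm_power)
        also have "\<dots> = 4 ^ s * exp (\<bar>- ?X\<bar> * (p * (1 - p) / 4)) * (\<bar>t\<bar> / d) ^ n"
          by (simp add: power_divide)
        also have "\<dots> \<le> 4 ^ s * exp (\<bar>- ?X\<bar> * (p * (1 - p) / 4)) * y ^ m"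
        proof (rule mult_left_mono)
          have "(\<bar>t\<bar> / d) ^ n \<le> y ^ n"
            using d by (intro power_mono) (auto simp: y_def field_simps)
          also have "\<dots> \<le> y ^ m" using y \<open>n \<in> {..<m}\<close> by (intro power_increasing) auto
          finally show "(\<bar>t\<bar> / d) ^ n \<le> y ^ m" .
        qed auto
        finally show "norm (fps_nth (edgeworth_fps p s (of_real (- ?X))) n * ?w ^ n)
          \<le> 4 ^ s * exp (\<bar>- ?X\<bar> * (p * (1 - p) / 4)) * y ^ m" .
      qed
      then have "norm (of_real ?g * ?P) \<le> ?g * (real m * (4 ^ s * exp (\<bar>- ?X\<bar> * (p * (1 - p) / 4)) * y ^ m))"
        unfolding norm_mult norm_of_real by (simp add: mult_left_mono)
      also have "\<dots> = real m * 4 ^ s * y ^ m * (?g * exp (\<bar>- ?X\<bar> * (p * (1 - p) / 4)))"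
        by (simp only: mult_ac)
      also have "\<dots> \<le> real m * 4 ^ s * y ^ m * exp (- (v / 12 * ?X))"
        using g y by (intro mult_left_mono) auto
      finally have "norm (?J - of_real ?g * ?P) \<le> exp (- (v / 12 * ?X)) * (2 ^ s * y ^ m) + real m * 4 ^ s * y ^ m * exp (- (v / 12 * ?X))"
        using J by (intro order.trans[OF norm_triangle_ineq4]) linarith
      also have "\<dots> = (real m * 4 ^ s + 2 ^ s) * y ^ m * exp (- (v / 12 * ?X))"
        by (simp add: algebra_simps)
      also have "\<dots> \<le> (2 * 4 ^ s + real m * 4 ^ s + 2 ^ s) * y ^ m * exp (- (v / 12 * ?X))"
        using y by (intro mult_right_mono) auto
      also have "\<dots> = C * \<bar>t\<bar> ^ m * exp (- (v / 12 * ?X))"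
        by (simp add: C_def y_def power_mult_distrib power_divide)
      finally show ?thesis .
    qed
    then show "norm (?J - of_real ?g * ?P) \<le> C * \<bar>t\<bar> ^ m * exp (- (v / 12 * real N * t\<^sup>2))"
      by (simp only: mult.assoc)
  qed
qed

end

section \<open>Gaussian integrals\<close>

lemma integrable_abs_power_gauss:
  assumes "0 < b"
  shows "integrable lborel (\<lambda>t::real. \<bar>t\<bar> ^ k * exp (- (b * t\<^sup>2)))"
proof -
  define \<sigma> where "\<sigma> = sqrt (1 / (2 * b))"
  have s: "\<sigma> > 0" "\<sigma>\<^sup>2 = 1 / (2 * b)" using assms by (auto simp: \<sigma>_def)
  have "integrable lborel (\<lambda>t. sqrt (2 * pi * \<sigma>\<^sup>2) * (normal_density 0 \<sigma> t * \<bar>t - 0\<bar> ^ k))"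
    by (intro integrable_mult_right integrable_normal_moment_abs s)
  moreover have "sqrt (2 * pi * \<sigma>\<^sup>2) * (normal_density 0 \<sigma> t * \<bar>t - 0\<bar> ^ k) = \<bar>t\<bar> ^ k * exp (- (b * t\<^sup>2))" for t
    unfolding normal_density_def s(2) using assms by (simp add: field_simps)
  ultimately show ?thesis by (simp only:)
qed

lemma integral_abs_power_gauss_scale:
  assumes "0 < N"
  shows "(LINT t|lborel. \<bar>t\<bar> ^ m * exp (- (c * N * t\<^sup>2)))
       = N powr (- (real m + 1) / 2) * (LINT t|lborel. \<bar>t\<bar> ^ m * exp (- (c * t\<^sup>2)))"
proof -
  have "(LINT t|lborel. \<bar>t\<bar> ^ m * exp (- (c * N * t\<^sup>2)))
     = \<bar>1 / sqrt N\<bar> *\<^sub>R (LINT t|lborel. \<bar>0 + 1 / sqrt N * t\<bar> ^ m * exp (- (c * N * (0 + 1 / sqrt N * t)\<^sup>2)))"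
    by (rule lborel_integral_real_affine) (use assms in auto)
  also have "\<dots> = \<bar>1 / sqrt N\<bar> *\<^sub>R (LINT t|lborel. (1 / sqrt N) ^ m * (\<bar>t\<bar> ^ m * exp (- (c * t\<^sup>2))))"
    using assms by (simp add: abs_mult power_mult_distrib power_divide mult_ac)
  also have "\<dots> = (1 / sqrt N) ^ Suc m * (LINT t|lborel. \<bar>t\<bar> ^ m * exp (- (c * t\<^sup>2)))"
    using assms by simp
  also have "(1 / sqrt N) ^ Suc m = N powr (- (real m + 1) / 2)"
  proof -
    have "1 / sqrt N = N powr (- 1 / 2)"
      using assms by (simp add: powr_minus_divide powr_half_sqrt)
    then have "(1 / sqrt N) ^ Suc m = (N powr (- 1 / 2)) powr (real (Suc m))"
      using assms by (subst powr_realpow) auto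
    also have "\<dots> = N powr (- 1 / 2 * real (Suc m))" by (simp only: powr_powr)
    also have "- 1 / 2 * real (Suc m) = - (real m + 1) / 2" by (simp add: field_simps)
    finally show ?thesis .
  qed
  finally show ?thesis .
qed

lemma norm_integral_le_integral:
  fixes f :: "'a \<Rightarrow> 'b::{banach, second_countable_topology}"
  assumes "integrable M f" "integrable M g" "\<And>x. norm (f x) \<le> g x"
  shows "norm (integral\<^sup>L M f) \<le> integral\<^sup>L M g"
proof -
  have "norm (integral\<^sup>L M f) \<le> (\<integral>x. norm (f x) \<partial>M)" by (rule integral_norm_bound)
  also have "\<dots> \<le> integral\<^sup>L M g" using assms by (intro integral_mono) auto
  finally show ?thesis .
qed

text \<open>Reduces differentiation under the integral sign to one explicit estimate, the
  second-order remainder of the exponential.\<close>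

lemma has_vector_derivative_quadraticI:
  fixes f :: "real \<Rightarrow> 'a::real_normed_vector"
  assumes "\<And>h. norm (f (x + h) - f x - h *\<^sub>R D) \<le> K * h\<^sup>2"
  shows "(f has_vector_derivative D) (at x)"
  unfolding has_vector_derivative_def has_derivative_at
proof (intro conjI bounded_linear_scaleR_left)
  show "(\<lambda>h. norm (f (x + h) - f x - h *\<^sub>R D) / norm h) \<midarrow>0\<rightarrow> 0"
  proof (rule tendsto_sandwich[OF _ _ tendsto_const])
    show "\<forall>\<^sub>F h in at 0. norm (f (x + h) - f x - h *\<^sub>R D) / norm h \<le> K * \<bar>h\<bar>"
      using assms by (intro always_eventually allI) (auto simp: divide_le_eq power2_eq_square mult_ac)
    show "((\<lambda>h. K * \<bar>h\<bar>) \<longlongrightarrow> 0) (at 0)"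
      by (auto intro!: tendsto_eq_intros)
  qed auto
qed

text \<open>Used with \<open>a = sqrt (2 N p (1 - p))\<close>: then \<open>a^2 / 4\<close> is the
  Gaussian exponent \<open>N p (1 - p) / 2\<close>, and \<open>exp (- \<i> a x t)\<close> is the
  phase left after centring at \<open>N p\<close>. The power is what \<open>m\<close>
  differentiations in \<open>x\<close> bring down.\<close>

definition gauss_fourier :: "real \<Rightarrow> nat \<Rightarrow> real \<Rightarrow> complex" where
  "gauss_fourier a m x =
     (LINT t|lborel. of_real (exp (- (a\<^sup>2 * t\<^sup>2 / 4))) * (- (\<i> * of_real (a * t))) ^ m * exp (- (\<i> * of_real (a * x * t))))"

lemma integrable_gauss_fourier:
  assumes "0 < a"
  shows "integrable lborel (\<lambda>t. of_real (exp (- (a\<^sup>2 * t\<^sup>2 / 4))) * (- (\<i> * of_real (a * t))) ^ m * exp (- (\<i> * of_real (a * x * t))))"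
proof (rule Bochner_Integration.integrable_bound)
  show "integrable lborel (\<lambda>t. a ^ m * (\<bar>t\<bar> ^ m * exp (- (a\<^sup>2 / 4 * t\<^sup>2))))"
    using assms by (intro integrable_mult_right integrable_abs_power_gauss) auto
  show "AE t in lborel. norm (of_real (exp (- (a\<^sup>2 * t\<^sup>2 / 4))) * (- (\<i> * of_real (a * t))) ^ m * exp (- (\<i> * of_real (a * x * t))))
     \<le> norm (a ^ m * (\<bar>t\<bar> ^ m * exp (- (a\<^sup>2 / 4 * t\<^sup>2))))"
    using assms by (intro AE_I2) (simp add: norm_mult norm_power norm_exp_eq_Re power_mult_distrib abs_mult)
qed auto

lemma gauss_fourier_has_vector_derivative:
  assumes a: "0 < a"
  shows "(gauss_fourier a m has_vector_derivative gauss_fourier a (Suc m) x) (at x)"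
proof (rule has_vector_derivative_quadraticI)
  fix h :: real
  let ?F = "\<lambda>m x t. of_real (exp (- (a\<^sup>2 * t\<^sup>2 / 4))) * (- (\<i> * complex_of_real (a * t))) ^ m * exp (- (\<i> * of_real (a * x * t)))"
  let ?B = "\<lambda>t. a ^ (m + 2) * (\<bar>t\<bar> ^ (m + 2) * exp (- (a\<^sup>2 / 4 * t\<^sup>2)))"
  have int: "integrable lborel ?B"
    using a by (intro integrable_mult_right integrable_abs_power_gauss) auto
  have diff: "gauss_fourier a m (x + h) - gauss_fourier a m x - h *\<^sub>R gauss_fourier a (Suc m) x
     = (LINT t|lborel. ?F m (x + h) t - ?F m x t - of_real h * ?F (Suc m) x t)"
    unfolding gauss_fourier_def scaleR_conv_of_real using integrable_gauss_fourier[OF a]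
    by (simp del: power_Suc of_real_mult)
  have "norm (LINT t|lborel. ?F m (x + h) t - ?F m x t - of_real h * ?F (Suc m) x t) \<le> (LINT t|lborel. h\<^sup>2 * ?B t)"
  proof (rule norm_integral_le_integral)
    show "integrable lborel (\<lambda>t. ?F m (x + h) t - ?F m x t - of_real h * ?F (Suc m) x t)"
      by (intro Bochner_Integration.integrable_diff integrable_mult_right integrable_gauss_fourier a)
    show "integrable lborel (\<lambda>t. h\<^sup>2 * ?B t)" using int by (rule integrable_mult_right)
    fix t
    have ex: "exp (- (\<i> * of_real (a * (x + h) * t))) = exp (- (\<i> * of_real (a * x * t))) * exp (\<i> * of_real (- (a * h * t)))"
      by (simp add: algebra_simps flip: exp_add)
    have "?F m (x + h) t - ?F m x t - of_real h * ?F (Suc m) x t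
       = ?F m x t * (exp (\<i> * of_real (- (a * h * t))) - (\<Sum>k\<le>1. (\<i> * of_real (- (a * h * t))) ^ k / fact k))"
      unfolding ex by (simp add: algebra_simps)
    also have "norm \<dots> \<le> norm (?F m x t) * (\<bar>- (a * h * t)\<bar> ^ Suc 1 / fact (Suc 1))"
      unfolding norm_mult[of "?F m x t"] by (intro mult_left_mono iexp_approx1) auto
    also have "\<dots> \<le> norm (?F m x t) * (\<bar>- (a * h * t)\<bar> ^ 2)"
    proof (intro mult_left_mono)
      have "\<bar>y\<bar> ^ Suc 1 / fact (Suc 1) \<le> \<bar>y\<bar> ^ 2" for y :: real
        by (simp add: power2_eq_square)
      then show "\<bar>- (a * h * t)\<bar> ^ Suc 1 / fact (Suc 1) \<le> \<bar>- (a * h * t)\<bar> ^ 2" .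
    qed auto
    also have "\<dots> = h\<^sup>2 * ?B t"
      using a by (simp add: norm_mult norm_power norm_exp_eq_Re power_mult_distrib abs_mult power_add) (simp add: power2_eq_square)
    finally show "norm (?F m (x + h) t - ?F m x t - of_real h * ?F (Suc m) x t) \<le> h\<^sup>2 * ?B t" .
  qed
  moreover have "(LINT t|lborel. h\<^sup>2 * ?B t) = integral\<^sup>L lborel ?B * h\<^sup>2"
    unfolding integral_mult_right_zero[of lborel "h\<^sup>2" ?B] by (rule mult.commute)
  ultimately show "norm (gauss_fourier a m (x + h) - gauss_fourier a m x - h *\<^sub>R gauss_fourier a (Suc m) x)
     \<le> integral\<^sup>L lborel ?B * h\<^sup>2" unfolding diff by (simp only:)
qed

text \<open>The substitution \<open>t = sqrt 2 u / a\<close> leads to the characteristic function of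
  the standard normal law at \<open>- sqrt 2 x\<close>.\<close>

lemma gauss_fourier_0:
  assumes a: "0 < a"
  shows "gauss_fourier a 0 x = of_real (2 * sqrt pi / a * exp (- x\<^sup>2))"
proof -
  have "gauss_fourier a 0 x = \<bar>sqrt 2 / a\<bar> *\<^sub>R (LINT u|lborel.
      of_real (exp (- (a\<^sup>2 * (0 + sqrt 2 / a * u)\<^sup>2 / 4))) * (- (\<i> * of_real (a * (0 + sqrt 2 / a * u)))) ^ 0 *
      exp (- (\<i> * of_real (a * x * (0 + sqrt 2 / a * u)))))"
    unfolding gauss_fourier_def by (rule lborel_integral_real_affine) (use a in auto)
  also have "\<dots> = (sqrt 2 / a) *\<^sub>R (LINT u|lborel. of_real (sqrt (2 * pi)) * (std_normal_density u *\<^sub>R exp (\<i> * of_real (- (sqrt 2 * x) * u))))"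
  proof -
    have "of_real (exp (- (a\<^sup>2 * (0 + sqrt 2 / a * u)\<^sup>2 / 4))) * (- (\<i> * of_real (a * (0 + sqrt 2 / a * u)))) ^ 0 *
      exp (- (\<i> * of_real (a * x * (0 + sqrt 2 / a * u)))) =
      of_real (sqrt (2 * pi)) * (std_normal_density u *\<^sub>R exp (\<i> * of_real (- (sqrt 2 * x) * u)))" for u
      using a by (simp add: std_normal_density_def scaleR_conv_of_real power_mult_distrib power_divide mult_ac)
    then show ?thesis using a by simp
  qed
  also have "\<dots> = (sqrt 2 / a) *\<^sub>R (of_real (sqrt (2 * pi)) * char std_normal_distribution (- (sqrt 2 * x)))"
  proof -
    have "char std_normal_distribution (- (sqrt 2 * x)) = (LINT u|lborel. std_normal_density u *\<^sub>R exp (\<i> * of_real (- (sqrt 2 * x) * u)))"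
      unfolding char_def by (subst integral_density) (auto simp: normal_density_nonneg)
    then show ?thesis by (simp only: integral_mult_right_zero)
  qed
  also have "\<dots> = of_real (sqrt 2 / a * (sqrt (2 * pi) * exp (- (sqrt 2 * x)\<^sup>2 / 2)))"
    by (simp add: char_std_normal_distribution scaleR_conv_of_real exp_of_real)
  also have "sqrt 2 / a * (sqrt (2 * pi) * exp (- (sqrt 2 * x)\<^sup>2 / 2)) = 2 * sqrt pi / a * exp (- x\<^sup>2)"
    by (simp add: real_sqrt_mult power_mult_distrib field_simps)
  finally show ?thesis .
qed

text \<open>One induction yields both facts, since an equation for \<open>deriv\<close> is of use
  only where the derivative exists: differentiability of the integral in \<open>x\<close> supplies
  the next derivative of the Gaussian. The second fact is later taken with
  \<open>a = 1\<close>.\<close>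

lemma gauss_fourier_eq:
  assumes a: "0 < a"
  shows "gauss_fourier a m x = of_real (2 * sqrt pi / a * (deriv ^^ m) (\<lambda>t. exp (- t\<^sup>2)) x)"
    and gauss_higher_deriv: "((deriv ^^ m) (\<lambda>t. exp (- t\<^sup>2)) has_real_derivative (deriv ^^ Suc m) (\<lambda>t. exp (- t\<^sup>2)) x) (at x)"
proof -
  let ?g = "\<lambda>m. (deriv ^^ m) (\<lambda>t::real. exp (- t\<^sup>2))"
  define c where "c = 2 * sqrt pi / a"
  have c: "c > 0" using a by (simp add: c_def)
  have step: "(?g m has_real_derivative ?g (Suc m) x) (at x) \<and> gauss_fourier a (Suc m) x = of_real (c * ?g (Suc m) x)"
    if eq: "\<And>x. gauss_fourier a m x = of_real (c * ?g m x)" for m x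
  proof -
    have D: "(gauss_fourier a m has_vector_derivative gauss_fourier a (Suc m) x) (at x)"
      by (rule gauss_fourier_has_vector_derivative[OF a])
    have "((\<lambda>x. Re (gauss_fourier a m x)) has_vector_derivative Re (gauss_fourier a (Suc m) x)) (at x)"
      using D by (rule bounded_linear.has_vector_derivative[OF bounded_linear_Re])
    then have "((\<lambda>x. c * ?g m x) has_real_derivative Re (gauss_fourier a (Suc m) x)) (at x)"
      by (simp add: has_real_derivative_iff_has_vector_derivative eq)
    from DERIV_cdivide[OF this, of c] have Dg: "(?g m has_real_derivative Re (gauss_fourier a (Suc m) x) / c) (at x)"
      using c by simp
    then have g: "?g (Suc m) x = Re (gauss_fourier a (Suc m) x) / c"
      by (simp add: DERIV_imp_deriv)
    have "((\<lambda>x. Im (gauss_fourier a m x)) has_vector_derivative Im (gauss_fourier a (Suc m) x)) (at x)"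
      using D by (rule bounded_linear.has_vector_derivative[OF bounded_linear_Im])
    then have "((\<lambda>x. 0 :: real) has_vector_derivative Im (gauss_fourier a (Suc m) x)) (at x)"
      by (simp add: eq)
    then have "Im (gauss_fourier a (Suc m) x) = 0"
      using vector_derivative_at[of "\<lambda>x. 0 :: real" _ x] by simp
    then show ?thesis using Dg c unfolding g by (simp add: complex_eq_iff)
  qed
  have eq: "gauss_fourier a m x = of_real (c * ?g m x)" for m x
    by (induction m arbitrary: x) (use step gauss_fourier_0[OF a] in \<open>auto simp: c_def\<close>)
  then show "gauss_fourier a m x = of_real (2 * sqrt pi / a * ?g m x)" by (simp add: c_def)
  show "(?g m has_real_derivative ?g (Suc m) x) (at x)" using step[OF eq] by simp
qed

section \<open>Coefficients of the expansion\<close>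

definition partition_tuples :: "nat \<Rightarrow> nat \<Rightarrow> (nat \<Rightarrow> nat) set" where
  "partition_tuples n \<nu> = {k \<in> {1..n} \<rightarrow>\<^sub>E UNIV. (\<Sum>m=1..n. m * k m) = \<nu>}"

lemma partition_tuples_le:
  assumes "k \<in> partition_tuples n \<nu>" "m \<in> {1..n}"
  shows "m * k m \<le> \<nu>"
proof -
  have "m * k m \<le> (\<Sum>m=1..n. m * k m)" using assms by (intro member_le_sum) auto
  then show ?thesis using assms by (simp add: partition_tuples_def)
qed

lemma finite_partition_tuples: "finite (partition_tuples n \<nu>)"
proof (rule finite_subset)
  show "partition_tuples n \<nu> \<subseteq> {1..n} \<rightarrow>\<^sub>E {..\<nu>}"
  proof
    fix k assume k: "k \<in> partition_tuples n \<nu>"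
    have "k m \<le> \<nu>" if "m \<in> {1..n}" for m
    proof -
      have "k m \<le> m * k m" using that by simp
      then show ?thesis using partition_tuples_le[OF k that] by linarith
    qed
    then show "k \<in> {1..n} \<rightarrow>\<^sub>E {..\<nu>}" using k by (auto simp: partition_tuples_def PiE_def)
  qed
qed (simp add: finite_PiE)

text \<open>What the tuple \<open>k\<close> contributes to the product of the series
  \<open>exp (x m w^m)\<close>, at the power of \<open>w\<close> given by its weighted sum.\<close>

definition tuple_weight :: "(nat \<Rightarrow> 'a::field_char_0) \<Rightarrow> nat \<Rightarrow> (nat \<Rightarrow> nat) \<Rightarrow> 'a" where
  "tuple_weight x n k = (\<Prod>m=1..n. x m ^ k m / fact (k m))"

lemma tuple_weight_upd:
  assumes "m \<in> {1..n}"
  shows "of_nat (Suc (k m)) * tuple_weight x n (k(m := Suc (k m))) = x m * tuple_weight x n k"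
proof -
  have "tuple_weight x n k' = x m ^ k' m / fact (k' m) * (\<Prod>i\<in>{1..n} - {m}. x i ^ k' i / fact (k' i))" for k'
    unfolding tuple_weight_def using assms by (subst prod.remove[of _ m]) auto
  moreover have "(\<Prod>i\<in>{1..n} - {m}. x i ^ (k(m := Suc (k m))) i / fact ((k(m := Suc (k m))) i))
     = (\<Prod>i\<in>{1..n} - {m}. x i ^ k i / fact (k i))"
    by (rule prod.cong) auto
  moreover have "of_nat (Suc (k m)) * (x m ^ Suc (k m) / fact (Suc (k m))) = x m * (x m ^ k m / fact (k m))"
    by (simp del: of_nat_Suc)
  ultimately show ?thesis by (simp only: mult.assoc[symmetric] fun_upd_same)
qed

text \<open>Tuples with \<open>k m = 0\<close> drop out. Lowering the entry at \<open>m\<close> by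
  one maps the others bijectively to the tuples of weighted sum \<open>\<nu> - m\<close>, and the
  factor \<open>k m\<close> cancels against the factorial.\<close>

lemma sum_tuple_weight_part:
  assumes m: "m \<in> {1..n}"
  shows "(\<Sum>k\<in>partition_tuples n \<nu>. of_nat (k m) * tuple_weight x n k)
       = (if m \<le> \<nu> then x m * (\<Sum>k\<in>partition_tuples n (\<nu> - m). tuple_weight x n k) else 0)"
proof -
  let ?Q = "{k \<in> partition_tuples n \<nu>. k m \<noteq> 0}"
  have eq: "(\<Sum>k\<in>partition_tuples n \<nu>. of_nat (k m) * tuple_weight x n k) = (\<Sum>k\<in>?Q. of_nat (k m) * tuple_weight x n k)"
    by (rule sum.mono_neutral_right) (auto simp: finite_partition_tuples)
  have sum_split: "(\<Sum>i=1..n. i * k i) = m * k m + (\<Sum>i\<in>{1..n} - {m}. i * k i)" for k :: "nat \<Rightarrow> nat"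
    using m by (subst sum.remove[of _ m]) auto
  show ?thesis
  proof (cases "m \<le> \<nu>")
    case False
    have "k m = 0" if "k \<in> partition_tuples n \<nu>" for k
      using partition_tuples_le[OF that m] False by (cases "k m") auto
    then have "(\<Sum>k\<in>partition_tuples n \<nu>. of_nat (k m) * tuple_weight x n k) = 0"
      by (intro sum.neutral) auto
    then show ?thesis using False by simp
  next
    case True
    have "(\<Sum>k\<in>?Q. of_nat (k m) * tuple_weight x n k) = (\<Sum>k\<in>partition_tuples n (\<nu> - m). x m * tuple_weight x n k)"
    proof (rule sum.reindex_bij_witness[of _ "\<lambda>k. k(m := Suc (k m))" "\<lambda>k. k(m := k m - 1)"])
      fix k assume k: "k \<in> ?Q"
      then obtain l where l: "k m = Suc l" by (auto simp: gr0_conv_Suc)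
      have "(\<Sum>i\<in>{1..n} - {m}. i * (k(m := k m - 1)) i) = (\<Sum>i\<in>{1..n} - {m}. i * k i)"
        by (rule sum.cong) auto
      then show "k(m := k m - 1) \<in> partition_tuples n (\<nu> - m)"
        using k m sum_split[of k] sum_split[of "k(m := k m - 1)"] l
        by (auto simp: partition_tuples_def PiE_def extensional_def)
      show "(k(m := k m - 1))(m := Suc ((k(m := k m - 1)) m)) = k" using l by auto
      show "x m * tuple_weight x n (k(m := k m - 1)) = of_nat (k m) * tuple_weight x n k"
      proof -
        have "k(m := Suc l) = k" using l by auto
        then show ?thesis using tuple_weight_upd[OF m, of "k(m := l)" x] l by simp
      qed
    next
      fix k assume k: "k \<in> partition_tuples n (\<nu> - m)"
      have "(\<Sum>i\<in>{1..n} - {m}. i * (k(m := Suc (k m))) i) = (\<Sum>i\<in>{1..n} - {m}. i * k i)"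
        by (rule sum.cong) auto
      then show "k(m := Suc (k m)) \<in> ?Q"
        using k m True sum_split[of k] sum_split[of "k(m := Suc (k m))"]
        by (auto simp: partition_tuples_def PiE_def extensional_def)
      show "(k(m := Suc (k m)))(m := (k(m := Suc (k m))) m - 1) = k" by auto
    qed
    then show ?thesis using True eq by (simp add: sum_distrib_left)
  qed
qed

text \<open>Write the factor \<open>\<nu>\<close> as the weighted sum of each tuple and exchange the
  sums; an entry at \<open>m > \<nu>\<close> must be \<open>0\<close> and contributes
  nothing.\<close>

lemma sum_tuple_weight_rec:
  assumes "\<nu> \<le> n"
  shows "of_nat \<nu> * (\<Sum>k\<in>partition_tuples n \<nu>. tuple_weight x n k)
       = (\<Sum>m=1..\<nu>. of_nat m * x m * (\<Sum>k\<in>partition_tuples n (\<nu> - m). tuple_weight x n k))"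
proof -
  have "of_nat \<nu> * (\<Sum>k\<in>partition_tuples n \<nu>. tuple_weight x n k)
      = (\<Sum>k\<in>partition_tuples n \<nu>. \<Sum>m=1..n. of_nat m * (of_nat (k m) * tuple_weight x n k))"
    unfolding sum_distrib_left
  proof (rule sum.cong[OF refl])
    fix k assume "k \<in> partition_tuples n \<nu>"
    then have "(of_nat \<nu> :: 'a) = (\<Sum>m=1..n. of_nat m * of_nat (k m))"
      by (auto simp: partition_tuples_def simp flip: of_nat_mult of_nat_sum)
    then show "of_nat \<nu> * tuple_weight x n k = (\<Sum>m=1..n. of_nat m * (of_nat (k m) * tuple_weight x n k))"
      by (simp add: sum_distrib_right mult.assoc)
  qed
  also have "\<dots> = (\<Sum>m=1..n. of_nat m * (\<Sum>k\<in>partition_tuples n \<nu>. of_nat (k m) * tuple_weight x n k))"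
    by (subst sum.swap) (simp add: sum_distrib_left)
  also have "\<dots> = (\<Sum>m=1..n. if m \<in> {1..\<nu>} then of_nat m * x m * (\<Sum>k\<in>partition_tuples n (\<nu> - m). tuple_weight x n k) else 0)"
    by (rule sum.cong) (auto simp: sum_tuple_weight_part mult.assoc)
  also have "\<dots> = (\<Sum>m=1..\<nu>. of_nat m * x m * (\<Sum>k\<in>partition_tuples n (\<nu> - m). tuple_weight x n k))"
    using assms by (subst sum.inter_restrict[symmetric]) (auto intro!: sum.cong)
  finally show ?thesis .
qed

text \<open>Both sides satisfy the recurrence that the differential equation \<open>F' = z A' F\<close> imposes on coefficients.
  The number \<open>n\<close> of parts is kept fixed, so that the recurrence stays within one family of tuples.\<close>

lemma fps_exp_compose_nth_tuples:
  fixes A :: "'a::field_char_0 fps"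
  assumes A: "fps_nth A 0 = 0" and "\<nu> \<le> n"
  shows "fps_nth (fps_exp z oo A) \<nu> = (\<Sum>k\<in>partition_tuples n \<nu>. tuple_weight (\<lambda>m. z * fps_nth A m) n k)"
  using assms(2)
proof (induction \<nu> rule: less_induct)
  case (less \<nu>)
  let ?E = "fps_exp z oo A"
  let ?S = "\<lambda>\<nu>. \<Sum>k\<in>partition_tuples n \<nu>. tuple_weight (\<lambda>m. z * fps_nth A m) n k"
  show ?case
  proof (cases \<nu>)
    case 0
    have "partition_tuples n 0 = {\<lambda>m\<in>{1..n}. 0}"
      by (auto simp: partition_tuples_def PiE_def extensional_def fun_eq_iff)
    then have "?S 0 = 1" by (simp add: tuple_weight_def)
    then show ?thesis using 0 by simp
  next
    case (Suc \<mu>)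
    have "fps_deriv ?E = fps_const z * (?E * fps_deriv A)"
      using fps_compose_deriv[OF A, of "fps_exp z"] by (simp add: fps_compose_mult_distrib A mult.assoc)
    then have "of_nat \<nu> * fps_nth ?E \<nu> = fps_nth (fps_const z * (fps_deriv A * ?E)) \<mu>"
      using Suc by (metis fps_deriv_nth mult.commute Suc_eq_plus1)
    also have "\<dots> = (\<Sum>j=0..\<mu>. of_nat (Suc j) * (z * fps_nth A (Suc j)) * fps_nth ?E (\<nu> - Suc j))"
      using Suc by (subst fps_mult_left_const_nth, subst fps_mult_nth) (simp add: sum_distrib_left mult_ac)
    also have "\<dots> = (\<Sum>m=1..\<nu>. of_nat m * (z * fps_nth A m) * fps_nth ?E (\<nu> - m))"
      unfolding Suc using sum.shift_bounds_cl_Suc_ivl[of "\<lambda>m. of_nat m * (z * fps_nth A m) * fps_nth ?E (Suc \<mu> - m)" 0 \<mu>] by simp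
    also have "\<dots> = (\<Sum>m=1..\<nu>. of_nat m * (z * fps_nth A m) * ?S (\<nu> - m))"
      using less.prems by (intro sum.cong refl) (auto simp: less.IH)
    also have "\<dots> = of_nat \<nu> * ?S \<nu>"
      by (rule sum_tuple_weight_rec[OF less.prems, symmetric])
    finally show ?thesis using Suc by (simp del: of_nat_Suc)
  qed
qed

lemma weighted_solutions_eq: "weighted_solutions \<nu> = partition_tuples \<nu> \<nu>"
  by (simp add: weighted_solutions_def partition_tuples_def)

lemma fps_exp_compose_nth:
  fixes A :: "'a::field_char_0 fps"
  assumes A: "fps_nth A 0 = 0"
  shows "fps_nth (fps_exp z oo A) \<nu>
       = (\<Sum>k\<in>weighted_solutions \<nu>. z ^ (\<Sum>m=1..\<nu>. k m) * (\<Prod>m=1..\<nu>. fps_nth A m ^ k m / fact (k m)))"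
  unfolding fps_exp_compose_nth_tuples[OF A order.refl] weighted_solutions_eq
  by (intro sum.cong refl) (simp add: tuple_weight_def power_mult_distrib power_sum prod.distrib flip: times_divide_eq_right)

text \<open>The substitution of \<open>- w\<close> for \<open>w\<close>: differences insert
  \<open>exp (- w) - 1\<close>, whereas \<open>exp_coeff\<close> belongs to
  \<open>exp w - 1\<close>.\<close>

lemma exp_neg_minus_one_power_nth:
  "fps_nth ((fps_exp (- 1) - 1) ^ s :: complex fps) n = (- 1) ^ n * of_real (fps_nth ((fps_exp 1 - 1) ^ s) n)"
proof (induction s arbitrary: n)
  case (Suc s)
  have 1: "fps_nth (fps_exp (- 1) - 1 :: complex fps) j = (- 1) ^ j * of_real (fps_nth (fps_exp 1 - 1) j)" for j
    by (cases j) auto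
  have "(- 1) ^ j * (- 1) ^ (n - j) = ((- 1) ^ n :: complex)" if "j \<le> n" for j
    using that by (simp flip: power_add)
  then show ?case
    unfolding power_Suc fps_mult_nth Suc.IH 1 of_real_sum sum_distrib_left
    by (intro sum.cong refl) (auto simp: mult_ac)
qed (auto simp: fps_one_nth)

text \<open>The zero of order \<open>s\<close> is what gains a factor \<open>N^(-1/2)\<close> for
  each difference.\<close>

lemma edgeworth_fps_nth_less:
  assumes "n < s"
  shows "fps_nth (edgeworth_fps p s z) n = 0"
  unfolding edgeworth_fps_def fps_mult_nth
  by (rule sum.neutral) (use assms in \<open>auto simp: startsby_zero_power_prefix\<close>)

lemma edgeworth_fps_nth_add:
  "fps_nth (edgeworth_fps p s z) (s + l)
     = (\<Sum>i\<le>l. (- 1) ^ (s + i) * of_real (exp_coeff s i) * fps_nth (fps_exp z oo excess_fps p) (l - i))"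
proof -
  let ?P = "(fps_exp (- 1) - 1) ^ s :: complex fps" and ?Q = "fps_exp z oo excess_fps p"
  have "fps_nth (edgeworth_fps p s z) (s + l) = (\<Sum>j\<in>{0..s + l}. fps_nth ?P j * fps_nth ?Q (s + l - j))"
    by (simp add: edgeworth_fps_def fps_mult_nth)
  also have "\<dots> = (\<Sum>j\<in>{0 + s..l + s}. fps_nth ?P j * fps_nth ?Q (s + l - j))"
    by (rule sum.mono_neutral_right) (auto simp: startsby_zero_power_prefix)
  also have "\<dots> = (\<Sum>i\<in>{0..l}. fps_nth ?P (i + s) * fps_nth ?Q (s + l - (i + s)))"
    by (rule sum.shift_bounds_cl_nat_ivl)
  also have "\<dots> = (\<Sum>i\<le>l. (- 1) ^ (s + i) * of_real (exp_coeff s i) * fps_nth ?Q (l - i))"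
    unfolding exp_neg_minus_one_power_nth atLeast0AtMost
    by (intro sum.cong refl) (simp add: exp_coeff_def add.commute)
  finally show ?thesis .
qed

lemma sum_lessThan_add:
  fixes f :: "nat \<Rightarrow> 'a::comm_monoid_add"
  shows "(\<Sum>n<s + m. f n) = (\<Sum>n<s. f n) + (\<Sum>l<m. f (s + l))"
  by (induction m) (simp_all add: add.assoc)

lemma sum_triangle_diag:
  fixes f :: "nat \<Rightarrow> nat \<Rightarrow> 'a::comm_monoid_add"
  shows "(\<Sum>l\<le>K. \<Sum>i\<le>l. f i (l - i)) = (\<Sum>i\<le>K. \<Sum>\<nu>\<le>K - i. f i \<nu>)"
proof -
  have "(\<Sum>(i, j)\<in>{(i, j). i + j \<le> K}. f i j) = (\<Sum>(i, j)\<in>(SIGMA i:{..K}. {..K - i}). f i j)"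
    by (rule sum.cong) auto
  then show ?thesis using sum.triangle_reindex_eq[of f K] by (simp add: sum.Sigma)
qed

text \<open>Powers are taken of \<open>- w = - \<i> t\<close>, since these correspond to derivatives
  in \<open>x\<close>. By \<open>z = N (- w)^2\<close> a tuple with sum \<open>S\<close> contributes
  \<open>N^S\<close> and \<open>2 S\<close> extra powers, and \<open>w^\<nu>\<close> gives the
  sign.\<close>

definition edgeworth_coeff :: "real \<Rightarrow> nat \<Rightarrow> nat \<Rightarrow> (nat \<Rightarrow> nat) \<Rightarrow> real" where
  "edgeworth_coeff p N \<nu> k = (- 1) ^ \<nu> * real N ^ (\<Sum>m=1..\<nu>. k m) *
     (\<Prod>m=1..\<nu>. (bernoulli_cumulant p (m + 2) / fact (m + 2)) ^ k m / fact (k m))"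

text \<open>The first \<open>s\<close> coefficients vanish, and the other \<open>K + 1\<close> are
  Cauchy products with \<open>i + \<nu> \<le> K\<close>, the triangular index set of
  \<open>psi\<close>. The degree in \<open>t\<close> exceeds that in \<open>w\<close> because
  \<open>z\<close> depends on \<open>t\<close> as well.\<close>

lemma edgeworth_polynomial:
  assumes p: "0 < p" "p < 1"
  shows "(\<Sum>n<s + Suc K. fps_nth (edgeworth_fps p s (of_real (- (real N * t\<^sup>2)))) n * (\<i> * of_real t) ^ n)
       = (\<Sum>i\<le>K. \<Sum>\<nu>\<le>K - i. \<Sum>k\<in>weighted_solutions \<nu>. of_real (exp_coeff s i * edgeworth_coeff p N \<nu> k) *
            (- (\<i> * of_real t)) ^ (s + i + (\<nu> + 2 * (\<Sum>m=1..\<nu>. k m))))" (is "?L = ?R")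
proof -
  let ?w = "\<i> * complex_of_real t" and ?z = "complex_of_real (- (real N * t\<^sup>2))"
  let ?b = "\<lambda>\<nu>. fps_nth (fps_exp ?z oo excess_fps p) \<nu> * ?w ^ \<nu>"
  have b: "?b \<nu> = (\<Sum>k\<in>weighted_solutions \<nu>. of_real (edgeworth_coeff p N \<nu> k) * (- ?w) ^ (\<nu> + 2 * (\<Sum>m=1..\<nu>. k m)))" for \<nu>
    unfolding fps_exp_compose_nth[OF excess_fps_0[OF p]] sum_distrib_right
  proof (rule sum.cong[OF refl])
    fix k assume "k \<in> weighted_solutions \<nu>"
    define S where "S = (\<Sum>m=1..\<nu>. k m)"
    have prod: "(\<Prod>m=1..\<nu>. fps_nth (excess_fps p) m ^ k m / fact (k m))
      = of_real (\<Prod>m=1..\<nu>. (bernoulli_cumulant p (m + 2) / fact (m + 2)) ^ k m / fact (k m))"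
      unfolding of_real_prod by (intro prod.cong refl) (simp add: excess_fps_nth[OF p])
    have "?z = of_real (real N) * (- ?w) ^ 2"
      by (simp add: power_mult_distrib)
    then have "?z ^ S = of_real (real N ^ S) * (- ?w) ^ (2 * S)"
      by (simp only: power_mult_distrib power_mult of_real_power)
    moreover have "?w ^ \<nu> = (- 1) ^ \<nu> * (- ?w) ^ \<nu>"
      by (simp flip: power_mult_distrib)
    ultimately have zw: "?z ^ S * ?w ^ \<nu> = of_real ((- 1) ^ \<nu> * real N ^ S) * (- ?w) ^ (\<nu> + 2 * S)"
      by (simp only: power_add of_real_mult of_real_power of_real_minus of_real_1 mult_ac)
    have zc: "?z ^ S * c * ?w ^ \<nu> = of_real ((- 1) ^ \<nu> * real N ^ S) * (- ?w) ^ (\<nu> + 2 * S) * c" for c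
      unfolding zw[symmetric] by (simp only: mult_ac)
    show "?z ^ (\<Sum>m=1..\<nu>. k m) * (\<Prod>m=1..\<nu>. fps_nth (excess_fps p) m ^ k m / fact (k m)) * ?w ^ \<nu>
       = of_real (edgeworth_coeff p N \<nu> k) * (- ?w) ^ (\<nu> + 2 * (\<Sum>m=1..\<nu>. k m))"
      unfolding prod edgeworth_coeff_def S_def[symmetric] zc by (simp only: of_real_mult mult_ac)
  qed
  have "?L = (\<Sum>n<s. fps_nth (edgeworth_fps p s ?z) n * ?w ^ n) + (\<Sum>l<Suc K. fps_nth (edgeworth_fps p s ?z) (s + l) * ?w ^ (s + l))"
    by (rule sum_lessThan_add)
  also have "\<dots> = (\<Sum>l\<le>K. fps_nth (edgeworth_fps p s ?z) (s + l) * ?w ^ (s + l))"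
    by (simp add: edgeworth_fps_nth_less lessThan_Suc_atMost)
  also have "\<dots> = (\<Sum>l\<le>K. \<Sum>i\<le>l. of_real (exp_coeff s i) * (- ?w) ^ (s + i) * ?b (l - i))"
    unfolding edgeworth_fps_nth_add sum_distrib_right
  proof (intro sum.cong refl)
    fix l i :: nat assume "i \<in> {..l}"
    then have "?w ^ (s + l) = ?w ^ (s + i) * ?w ^ (l - i)" by (simp flip: power_add)
    moreover have "(- ?w) ^ (s + i) = (- 1) ^ (s + i) * ?w ^ (s + i)"
      by (simp flip: power_mult_distrib)
    ultimately show "(- 1) ^ (s + i) * of_real (exp_coeff s i) * fps_nth (fps_exp ?z oo excess_fps p) (l - i) * ?w ^ (s + l)
      = of_real (exp_coeff s i) * (- ?w) ^ (s + i) * ?b (l - i)" by (simp only: mult_ac)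
  qed
  also have "\<dots> = (\<Sum>i\<le>K. \<Sum>\<nu>\<le>K - i. of_real (exp_coeff s i) * (- ?w) ^ (s + i) * ?b \<nu>)"
    by (rule sum_triangle_diag)
  also have "\<dots> = ?R"
    unfolding b sum_distrib_left
    by (intro sum.cong refl) (simp only: power_add of_real_mult mult_ac)
  finally show ?thesis .
qed

section \<open>The functions \<open>psi\<close> in terms of derivatives of the Gaussian\<close>

lemma higher_deriv_sum:
  fixes f :: "nat \<Rightarrow> real \<Rightarrow> real"
  assumes "finite W" and D: "\<And>m x. (f m has_real_derivative f (Suc m) x) (at x)"
  shows "(deriv ^^ r) (\<lambda>t. \<Sum>k\<in>W. c k * f (j k) t) = (\<lambda>x. \<Sum>k\<in>W. c k * f (j k + r) x)"
proof (induction r)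
  case (Suc r)
  have "((\<lambda>x. \<Sum>k\<in>W. c k * f (j k + r) x) has_real_derivative (\<Sum>k\<in>W. c k * f (j k + Suc r) x)) (at x)" for x
    unfolding add_Suc_right by (intro DERIV_sum DERIV_cmult D)
  then show ?case using Suc by (auto intro!: DERIV_imp_deriv)
qed simp

text \<open>By Rodrigues' formula \<open>exp (- x^2)\<close> times a Hermite polynomial is a signed
  derivative of the Gaussian. Its order is \<open>\<nu>\<close> plus an even number, so the sign is
  \<open>(- 1)^\<nu>\<close>.\<close>

lemma exp_g_tilde:
  "exp (- x\<^sup>2) * g_tilde p \<nu> r x = (\<Sum>k\<in>weighted_solutions \<nu>.
     (- 1) ^ \<nu> / 2 powr (real \<nu> / 2 + real (\<Sum>m=1..\<nu>. k m)) *
     (\<Prod>m=1..\<nu>. 1 / fact (k m) * (bernoulli_cumulant p (m + 2) / (fact (m + 2) * sqrt (p * (1 - p)) ^ (m + 2))) ^ k m) *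
     (deriv ^^ (\<nu> + 2 * (\<Sum>m=1..\<nu>. k m) + r)) (\<lambda>t. exp (- t\<^sup>2)) x)"
proof -
  let ?c = "\<lambda>k. (- 1) ^ \<nu> / 2 powr (real \<nu> / 2 + real (\<Sum>m=1..\<nu>. k m)) *
     (\<Prod>m=1..\<nu>. 1 / fact (k m) * (bernoulli_cumulant p (m + 2) / (fact (m + 2) * sqrt (p * (1 - p)) ^ (m + 2))) ^ k m)"
  have "exp (- t\<^sup>2) * q_tilde p \<nu> t = (\<Sum>k\<in>weighted_solutions \<nu>. ?c k * (deriv ^^ (\<nu> + 2 * (\<Sum>m=1..\<nu>. k m))) (\<lambda>t. exp (- t\<^sup>2)) t)" for t
    unfolding q_tilde_def Let_def sum_distrib_left[where r = "exp (- t\<^sup>2)"]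
  proof (intro sum.cong refl)
    fix k :: "nat \<Rightarrow> nat"
    define S P where "S = (\<Sum>m=1..\<nu>. k m)" and "P = (\<Prod>m=1..\<nu>. 1 / fact (k m) * (bernoulli_cumulant p (m + 2) / (fact (m + 2) * sqrt (p * (1 - p)) ^ (m + 2))) ^ k m)"
    have "exp (- t\<^sup>2) * hermite (\<nu> + 2 * S) t = (exp (- t\<^sup>2) * exp (t\<^sup>2)) * ((- 1) ^ \<nu> * (deriv ^^ (\<nu> + 2 * S)) (\<lambda>t. exp (- t\<^sup>2)) t)"
      by (simp add: hermite_def power_add power_mult)
    then have "exp (- t\<^sup>2) * hermite (\<nu> + 2 * S) t = (- 1) ^ \<nu> * (deriv ^^ (\<nu> + 2 * S)) (\<lambda>t. exp (- t\<^sup>2)) t"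
      by (simp flip: exp_add)
    then show "exp (- t\<^sup>2) * (1 / 2 powr (real \<nu> / 2 + real (\<Sum>m=1..\<nu>. k m)) * hermite (\<nu> + 2 * (\<Sum>m=1..\<nu>. k m)) t *
         (\<Prod>m=1..\<nu>. 1 / fact (k m) * (bernoulli_cumulant p (m + 2) / (fact (m + 2) * sqrt (p * (1 - p)) ^ (m + 2))) ^ k m))
       = ?c k * (deriv ^^ (\<nu> + 2 * (\<Sum>m=1..\<nu>. k m))) (\<lambda>t. exp (- t\<^sup>2)) t"
      unfolding S_def[symmetric] P_def[symmetric] by (simp add: field_simps)
  qed
  then have "(deriv ^^ r) (\<lambda>t. exp (- t\<^sup>2) * q_tilde p \<nu> t) x
     = (\<Sum>k\<in>weighted_solutions \<nu>. ?c k * (deriv ^^ (\<nu> + 2 * (\<Sum>m=1..\<nu>. k m) + r)) (\<lambda>t. exp (- t\<^sup>2)) x)"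
    using higher_deriv_sum[where f = "\<lambda>m. (deriv ^^ m) (\<lambda>t. exp (- t\<^sup>2))" and c = ?c and j = "\<lambda>k. \<nu> + 2 * (\<Sum>m=1..\<nu>. k m)",
        OF finite_weighted_solutions gauss_higher_deriv[OF zero_less_one]]
    by simp
  moreover have "exp (- x\<^sup>2) * g_tilde p \<nu> r x = (deriv ^^ r) (\<lambda>t. exp (- t\<^sup>2) * q_tilde p \<nu> t) x"
    by (simp add: g_tilde_def flip: mult.assoc exp_add)
  ultimately show ?thesis by simp
qed

text \<open>A count of powers. The sum of \<open>(m + 2) k_m\<close> is \<open>\<nu> + 2 S\<close>,
  so the denominators combine to
  \<open>\<sigma>^(\<nu> + 2 S) 2^(\<nu> / 2 + S) N^(\<nu> / 2)\<close>; multiplied by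
  \<open>N^S\<close>, which \<open>edgeworth_coeff\<close> compensates, this is the reciprocal of
  the power of \<open>step\<close>.\<close>

lemma edgeworth_coeff_step:
  assumes p: "0 < p" "p < 1" and N: "0 < N" and k: "k \<in> weighted_solutions \<nu>"
  shows "(- 1) ^ \<nu> / 2 powr (real \<nu> / 2 + real (\<Sum>m=1..\<nu>. k m)) *
     (\<Prod>m=1..\<nu>. 1 / fact (k m) * (bernoulli_cumulant p (m + 2) / (fact (m + 2) * sqrt (p * (1 - p)) ^ (m + 2))) ^ k m)
       / real N powr (real \<nu> / 2)
     = edgeworth_coeff p N \<nu> k * step p N ^ (\<nu> + 2 * (\<Sum>m=1..\<nu>. k m))"
proof -
  define S where "S = (\<Sum>m=1..\<nu>. k m)"
  define \<sigma> where "\<sigma> = sqrt (p * (1 - p))"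
  define P where "P = (\<Prod>m=1..\<nu>. (bernoulli_cumulant p (m + 2) / fact (m + 2)) ^ k m / fact (k m))"
  have s: "\<sigma> > 0" using p by (simp add: \<sigma>_def)
  have gen: "1 / g * (b / (f * \<sigma> ^ (m + 2))) ^ j = ((b / f) ^ j / g) / \<sigma> ^ (m * j + 2 * j)"
    for b f g :: real and m j :: nat
  proof -
    have "(\<sigma> ^ (m + 2)) ^ j = \<sigma> ^ (m * j + 2 * j)"
      by (simp only: power_mult[symmetric] distrib_right)
    then show ?thesis by (simp only: power_divide power_mult_distrib) simp
  qed
  have "(\<Prod>m=1..\<nu>. 1 / fact (k m) * (bernoulli_cumulant p (m + 2) / (fact (m + 2) * \<sigma> ^ (m + 2))) ^ k m)
    = (\<Prod>m=1..\<nu>. ((bernoulli_cumulant p (m + 2) / fact (m + 2)) ^ k m / fact (k m)) / \<sigma> ^ (m * k m + 2 * k m))"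
    by (intro prod.cong refl gen)
  also have "\<dots> = P / \<sigma> ^ (\<nu> + 2 * S)"
  proof -
    have "(\<Sum>m=1..\<nu>. m * k m + 2 * k m) = \<nu> + 2 * S"
      using k by (simp add: weighted_solutions_def sum.distrib S_def sum_distrib_left)
    then show ?thesis by (simp only: prod_dividef P_def power_sum[symmetric])
  qed
  finally have 1: "(\<Prod>m=1..\<nu>. 1 / fact (k m) * (bernoulli_cumulant p (m + 2) / (fact (m + 2) * \<sigma> ^ (m + 2))) ^ k m) = P / \<sigma> ^ (\<nu> + 2 * S)" .
  have half: "sqrt y ^ (\<nu> + 2 * S) = y powr (real \<nu> / 2) * y ^ S" if "y > 0" for y
  proof -
    have "sqrt y ^ \<nu> = y powr (real \<nu> / 2)"
      using that by (simp add: powr_half_sqrt[symmetric] powr_powr flip: powr_realpow)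
    moreover have "sqrt y ^ (2 * S) = y ^ S" using that by (simp add: power_mult)
    ultimately show ?thesis by (simp add: power_add)
  qed
  have "step p N = 1 / (sqrt 2 * sqrt (real N) * \<sigma>)"
    by (simp add: step_def \<sigma>_def real_sqrt_mult)
  then have 2: "step p N ^ (\<nu> + 2 * S) = 1 / (2 powr (real \<nu> / 2) * 2 ^ S * (real N powr (real \<nu> / 2) * real N ^ S) * \<sigma> ^ (\<nu> + 2 * S))"
    using half[of 2] half[of "real N"] N by (simp add: power_divide power_mult_distrib)
  have 3: "2 powr (real \<nu> / 2 + real S) = 2 powr (real \<nu> / 2) * 2 ^ S"
    by (simp add: powr_add powr_realpow)
  have 4: "e / (a * b) * (P / s) / c = e * n * P * (1 / (a * b * (c * n) * s))" if "n \<noteq> 0" for a b c e n s :: real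
    using that by (simp add: mult_ac)
  show ?thesis
    unfolding \<sigma>_def[symmetric] S_def[symmetric] 1 2 3 edgeworth_coeff_def P_def[symmetric]
    by (rule 4) (use N in simp)
qed

text \<open>Matches \<open>edgeworth_polynomial\<close> term by term, with
  \<open>(- \<i> t)^e\<close> replaced by \<open>h^e D^e exp (- x^2)\<close>. Up to a common factor
  this replacement is the effect of the Gaussian Fourier integral.\<close>

lemma exp_psi:
  assumes p: "0 < p" "p < 1" and N: "0 < N"
  shows "exp (- x\<^sup>2) * psi p N K s x
       = (\<Sum>i\<le>K. \<Sum>\<nu>\<le>K - i. \<Sum>k\<in>weighted_solutions \<nu>. exp_coeff s i * edgeworth_coeff p N \<nu> k *
            (step p N ^ (s + i + (\<nu> + 2 * (\<Sum>m=1..\<nu>. k m))) *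
             (deriv ^^ (s + i + (\<nu> + 2 * (\<Sum>m=1..\<nu>. k m)))) (\<lambda>t. exp (- t\<^sup>2)) x))"
proof -
  have *: "exp (- x\<^sup>2) * g_tilde p \<nu> r x / real N powr (real \<nu> / 2) * step p N ^ r
    = (\<Sum>k\<in>weighted_solutions \<nu>. edgeworth_coeff p N \<nu> k * (step p N ^ (r + (\<nu> + 2 * (\<Sum>m=1..\<nu>. k m))) *
             (deriv ^^ (r + (\<nu> + 2 * (\<Sum>m=1..\<nu>. k m)))) (\<lambda>t. exp (- t\<^sup>2)) x))" for \<nu> r
    unfolding exp_g_tilde sum_divide_distrib sum_distrib_right
  proof (intro sum.cong refl)
    fix k assume k: "k \<in> weighted_solutions \<nu>"
    define S P where "S = (\<Sum>m=1..\<nu>. k m)" and "P = (\<Prod>m=1..\<nu>. 1 / fact (k m) * (bernoulli_cumulant p (m + 2) / (fact (m + 2) * sqrt (p * (1 - p)) ^ (m + 2))) ^ k m)"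
    define D where "D = (deriv ^^ (\<nu> + 2 * S + r)) (\<lambda>t. exp (- t\<^sup>2)) x"
    have "(- 1) ^ \<nu> / 2 powr (real \<nu> / 2 + real S) * P * D / real N powr (real \<nu> / 2) * step p N ^ r
      = ((- 1) ^ \<nu> / 2 powr (real \<nu> / 2 + real S) * P / real N powr (real \<nu> / 2)) * (step p N ^ r * D)"
      by simp
    also have "\<dots> = edgeworth_coeff p N \<nu> k * step p N ^ (\<nu> + 2 * S) * (step p N ^ r * D)"
      unfolding S_def P_def edgeworth_coeff_step[OF p N k] ..
    also have "\<dots> = edgeworth_coeff p N \<nu> k * (step p N ^ (r + (\<nu> + 2 * S)) * (deriv ^^ (r + (\<nu> + 2 * S))) (\<lambda>t. exp (- t\<^sup>2)) x)"
      by (simp add: D_def power_add add_ac mult_ac)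
    finally show "(- 1) ^ \<nu> / 2 powr (real \<nu> / 2 + real (\<Sum>m=1..\<nu>. k m)) *
     (\<Prod>m=1..\<nu>. 1 / fact (k m) * (bernoulli_cumulant p (m + 2) / (fact (m + 2) * sqrt (p * (1 - p)) ^ (m + 2))) ^ k m) *
     (deriv ^^ (\<nu> + 2 * (\<Sum>m=1..\<nu>. k m) + r)) (\<lambda>t. exp (- t\<^sup>2)) x / real N powr (real \<nu> / 2) * step p N ^ r =
     edgeworth_coeff p N \<nu> k * (step p N ^ (r + (\<nu> + 2 * (\<Sum>m=1..\<nu>. k m))) *
             (deriv ^^ (r + (\<nu> + 2 * (\<Sum>m=1..\<nu>. k m)))) (\<lambda>t. exp (- t\<^sup>2)) x)"
      unfolding S_def P_def D_def .
  qed
  have "exp (- x\<^sup>2) * psi p N K s x = (\<Sum>i\<le>K. exp_coeff s i * (\<Sum>\<nu>\<le>K - i.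
      exp (- x\<^sup>2) * g_tilde p \<nu> (s + i) x / real N powr (real \<nu> / 2) * step p N ^ (s + i)))"
    unfolding psi_def sum_distrib_left by (intro sum.cong refl) (simp add: mult_ac)
  then show ?thesis
    unfolding * sum_distrib_left by (simp only: mult.assoc)
qed

section \<open>Expansion of the differences of the weight\<close>

lemma power_le_powr_bound:
  fixes \<theta> b :: real
  assumes "0 \<le> \<theta>" "\<theta> < 1"
  obtains C where "0 \<le> C" "\<And>N::nat. 0 < N \<Longrightarrow> \<theta> ^ N \<le> C * real N powr (- b)"
proof (cases "\<theta> = 0")
  \<comment> \<open>This case arises for \<open>p = 1 / 2\<close>, where the base
    \<open>\<bar>1 - 2 * p\<bar>\<close> vanishes.\<close>
  case True
  then show ?thesis by (intro that[of 0]) (auto simp: zero_power)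
next
  case False
  then have t: "0 < \<theta>" using assms by simp
  have "(\<lambda>N::nat. real N powr b * \<theta> ^ N) \<longlonglongrightarrow> 0"
    using t assms by real_asymp
  then have "Bseq (\<lambda>N::nat. real N powr b * \<theta> ^ N)"
    by (intro convergent_imp_Bseq convergentI)
  then obtain C where C: "0 < C" "\<And>N::nat. norm (real N powr b * \<theta> ^ N) \<le> C"
    by (auto elim: BseqE)
  show ?thesis
  proof (rule that[of C])
    fix N :: nat assume N: "0 < N"
    have "real N powr b * \<theta> ^ N \<le> C" using C(2)[of N] by simp
    then show "\<theta> ^ N \<le> C * real N powr (- b)"
      using N by (simp add: powr_minus field_simps)
  qed (use C in simp)
qed

context
  fixes p :: real
  assumes p: "0 < p" "p < 1"
begin

text \<open>After centring, \<open>x\<close> enters only through a phase of modulus one, so the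
  constant is independent of \<open>x\<close>. The integrability hypothesis is met in two ways: for
  \<open>m = s\<close> the polynomial vanishes, and for \<open>m = s + K + 1\<close> it leads to
  integrands of \<open>gauss_fourier\<close>.\<close>

lemma fwd_diff_weight_approx:
  assumes int: "\<And>N x. 0 < N \<Longrightarrow> integrable lborel (\<lambda>t. of_real (exp (- (real N * (p * (1 - p)) * t\<^sup>2 / 2))) *
         (\<Sum>n<m. fps_nth (edgeworth_fps p s (of_real (- (real N * t\<^sup>2)))) n * (\<i> * of_real t) ^ n) *
         exp (- (\<i> * of_real (sqrt (2 * real N * p * (1 - p)) * x * t))))"
  obtains C where "0 \<le> C" "\<And>N x. 0 < N \<Longrightarrow> 0 \<le> xhat p N x \<Longrightarrow> xhat p N x + real s \<le> real N \<Longrightarrow>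
     norm (of_real ((fwd_diff ^^ s) (weight p N) (xhat p N x)) -
       (LINT t|lborel. of_real (exp (- (real N * (p * (1 - p)) * t\<^sup>2 / 2))) *
         (\<Sum>n<m. fps_nth (edgeworth_fps p s (of_real (- (real N * t\<^sup>2)))) n * (\<i> * of_real t) ^ n) *
         exp (- (\<i> * of_real (sqrt (2 * real N * p * (1 - p)) * x * t)))) / of_real (2 * pi))
      \<le> C * real N powr (- (real m + 1) / 2)"
proof -
  obtain C c where C: "0 < c" "0 \<le> C"
    "\<And>N t. norm (indicator {- pi..pi} t *\<^sub>R
        ((of_real (1 - p) + of_real p * exp (\<i> * of_real t)) ^ N * exp (- (\<i> * of_real (real N * p * t))) *
         (exp (- (\<i> * of_real t)) - 1) ^ s)
       - of_real (exp (- (real N * (p * (1 - p)) * t\<^sup>2 / 2))) *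
         (\<Sum>n<m. fps_nth (edgeworth_fps p s (of_real (- (real N * t\<^sup>2)))) n * (\<i> * of_real t) ^ n))
       \<le> C * \<bar>t\<bar> ^ m * exp (- (c * real N * t\<^sup>2))"
    by (rule char_integrand_bound[OF p, of s m]) (rule that)
  have "\<bar>1 - 2 * p\<bar> < 1" using p by (auto simp: abs_less_iff)
  then obtain D where D: "0 \<le> D" "\<And>N::nat. 0 < N \<Longrightarrow> \<bar>1 - 2 * p\<bar> ^ N \<le> D * real N powr (- ((real m + 1) / 2))"
    by (rule power_le_powr_bound[OF abs_ge_zero]) (rule that)
  define I where "I = (LINT t|lborel. \<bar>t\<bar> ^ m * exp (- (c * t\<^sup>2)))"
  define L where "L = 2 ^ s * \<bar>ln (p / (1 - p))\<bar>"
  have I0: "0 \<le> I" unfolding I_def by (rule integral_nonneg_AE) auto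
  show thesis
  proof (rule that[of "L * D + C * I"])
    show "0 \<le> L * D + C * I" using D C I0 by (simp add: L_def)
    fix N :: nat and x :: real
    assume N: "0 < N" and x: "0 \<le> xhat p N x" "xhat p N x + real s \<le> real N"
    define a where "a = sqrt (2 * real N * p * (1 - p))"
    let ?y = "xhat p N x"
    let ?W = "of_real ((fwd_diff ^^ s) (weight p N) ?y) :: complex"
    let ?e = "\<lambda>t. exp (- (\<i> * complex_of_real (a * x * t)))"
    let ?z = "\<lambda>t. of_real (1 - p) + of_real p * exp (\<i> * complex_of_real t)"
    let ?Jc = "\<lambda>t. indicator {- pi..pi} t *\<^sub>R (?z t ^ N * exp (- (\<i> * of_real (real N * p * t))) * (exp (- (\<i> * of_real t)) - 1) ^ s)"
    let ?J = "\<lambda>t. indicator {- pi..pi} t *\<^sub>R (exp (- (\<i> * of_real (?y * t))) * ?z t ^ N * (exp (- (\<i> * of_real t)) - 1) ^ s)"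
    let ?Tc = "\<lambda>t. of_real (exp (- (real N * (p * (1 - p)) * t\<^sup>2 / 2))) *
         (\<Sum>n<m. fps_nth (edgeworth_fps p s (of_real (- (real N * t\<^sup>2)))) n * (\<i> * of_real t) ^ n)"
    let ?T = "\<lambda>t. ?Tc t * ?e t"
    have J: "?J t = ?Jc t * ?e t" for t
    proof -
      have shift: "exp (- (\<i> * of_real (?y * t))) = exp (- (\<i> * of_real (real N * p * t))) * ?e t"
        by (simp add: xhat_def a_def algebra_simps flip: exp_add)
      have reassoc: "c *\<^sub>R (u * z * d) = c *\<^sub>R (z * v * d) * e" if "u = v * e" for c :: real and u v z d e :: complex
        unfolding that by simp
      show ?thesis by (rule reassoc[OF shift])
    qed
    have "continuous_on {- pi..pi} (\<lambda>t. exp (- (\<i> * of_real (?y * t))) * ?z t ^ N * (exp (- (\<i> * of_real t)) - 1) ^ s)"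
      by (intro continuous_intros)
    then have intJ: "integrable lborel ?J"
      using borel_integrable_atLeastAtMost' unfolding set_integrable_def by blast
    have intT: "integrable lborel ?T" using int[OF N, of x] by (simp only: a_def)
    have "norm (integral\<^sup>L lborel ?J - integral\<^sup>L lborel ?T) = norm (LINT t|lborel. ?J t - ?T t)"
      by (simp only: Bochner_Integration.integral_diff[OF intJ intT])
    also have "\<dots> \<le> (LINT t|lborel. C * (\<bar>t\<bar> ^ m * exp (- (c * real N * t\<^sup>2))))"
    proof (rule norm_integral_le_integral)
      show "integrable lborel (\<lambda>t. ?J t - ?T t)" using intJ intT by (rule Bochner_Integration.integrable_diff)
      show "integrable lborel (\<lambda>t. C * (\<bar>t\<bar> ^ m * exp (- (c * real N * t\<^sup>2))))"
        using C(1) N by (intro integrable_mult_right integrable_abs_power_gauss) auto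
      fix t :: real
      have "norm (?e t) = 1" by (simp add: norm_exp_eq_Re)
      moreover have "?J t - ?T t = (?Jc t - ?Tc t) * ?e t" unfolding J by (simp only: left_diff_distrib)
      ultimately have "norm (?J t - ?T t) = norm (?Jc t - ?Tc t)" by (simp only: norm_mult mult_1_right)
      then show "norm (?J t - ?T t) \<le> C * (\<bar>t\<bar> ^ m * exp (- (c * real N * t\<^sup>2)))"
        using C(3)[of t N] by (simp only: mult.assoc)
    qed
    also have "\<dots> = C * I * real N powr (- (real m + 1) / 2)"
      using integral_abs_power_gauss_scale[of "real N" m c] N by (simp add: I_def)
    finally have 1: "norm (integral\<^sup>L lborel ?J - integral\<^sup>L lborel ?T) \<le> C * I * real N powr (- (real m + 1) / 2)" .
    have "norm (integral\<^sup>L lborel ?J / of_real (2 * pi) - integral\<^sup>L lborel ?T / of_real (2 * pi))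
       = norm (integral\<^sup>L lborel ?J - integral\<^sup>L lborel ?T) / (2 * pi)"
      unfolding diff_divide_distrib[symmetric] norm_divide norm_of_real by simp
    also have "\<dots> \<le> norm (integral\<^sup>L lborel ?J - integral\<^sup>L lborel ?T)"
      using pi_gt3 by (simp add: divide_le_eq mult_le_cancel_left1)
    finally have 2: "norm (integral\<^sup>L lborel ?J / of_real (2 * pi) - integral\<^sup>L lborel ?T / of_real (2 * pi)) \<le> C * I * real N powr (- (real m + 1) / 2)"
      using 1 by linarith
    have "norm (?W - integral\<^sup>L lborel ?J / of_real (2 * pi)) \<le> L * \<bar>1 - 2 * p\<bar> ^ N"
      using fwd_diff_weight_char_integral_bound[OF p x] by (simp add: L_def)
    also have "\<dots> \<le> L * (D * real N powr (- ((real m + 1) / 2)))"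
      using D(2)[OF N] by (intro mult_left_mono) (auto simp: L_def)
    finally have 3: "norm (?W - integral\<^sup>L lborel ?J / of_real (2 * pi)) \<le> L * D * real N powr (- (real m + 1) / 2)"
      by (simp add: minus_divide_left algebra_simps)
    have "norm (?W - integral\<^sup>L lborel ?T / of_real (2 * pi))
      \<le> norm (?W - integral\<^sup>L lborel ?J / of_real (2 * pi)) + norm (integral\<^sup>L lborel ?J / of_real (2 * pi) - integral\<^sup>L lborel ?T / of_real (2 * pi))"
      by (rule norm_triangle_ineq[THEN order.trans[rotated]]) simp
    also have "\<dots> \<le> (L * D + C * I) * real N powr (- (real m + 1) / 2)"
      using 2 3 unfolding distrib_right by linarith
    finally show "norm (?W - (LINT t|lborel. of_real (exp (- (real N * (p * (1 - p)) * t\<^sup>2 / 2))) *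
         (\<Sum>n<m. fps_nth (edgeworth_fps p s (of_real (- (real N * t\<^sup>2)))) n * (\<i> * of_real t) ^ n) *
         exp (- (\<i> * of_real (sqrt (2 * real N * p * (1 - p)) * x * t)))) / of_real (2 * pi))
      \<le> (L * D + C * I) * real N powr (- (real m + 1) / 2)" by (simp only: a_def)
  qed
qed

text \<open>The case \<open>m = s\<close>: all coefficients of the comparison polynomial vanish, and
  the remainder is the whole difference.\<close>

lemma fwd_diff_weight_bound:
  obtains C where "0 \<le> C" "\<And>N x. 0 < N \<Longrightarrow> 0 \<le> xhat p N x \<Longrightarrow> xhat p N x + real s \<le> real N \<Longrightarrow>
     \<bar>(fwd_diff ^^ s) (weight p N) (xhat p N x)\<bar> \<le> C * real N powr (- (real s + 1) / 2)"
proof -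
  have zero: "(\<Sum>n<s. fps_nth (edgeworth_fps p s z) n * w ^ n) = 0" for z w
    by (simp add: edgeworth_fps_nth_less)
  obtain C where "0 \<le> C" "\<And>N x. 0 < N \<Longrightarrow> 0 \<le> xhat p N x \<Longrightarrow> xhat p N x + real s \<le> real N \<Longrightarrow>
     norm (of_real ((fwd_diff ^^ s) (weight p N) (xhat p N x)) - (0 :: complex)) \<le> C * real N powr (- (real s + 1) / 2)"
    by (rule fwd_diff_weight_approx[of s s]) (simp_all add: zero)
  then show thesis by (intro that[of C]) auto
qed

text \<open>The case \<open>m = s + K + 1\<close>: the polynomial part integrates exactly to the
  \<open>psi\<close> term, and the remainder has exponent
  \<open>- (m + 1) / 2 = - (s + K + 2) / 2\<close>.\<close>

lemma fwd_diff_weight_psi: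
  obtains C where "0 \<le> C" "\<And>N x. 0 < N \<Longrightarrow> 0 \<le> xhat p N x \<Longrightarrow> xhat p N x + real s \<le> real N \<Longrightarrow>
     \<bar>(fwd_diff ^^ s) (weight p N) (xhat p N x) -
       exp (- (x\<^sup>2)) / (sqrt (2 * pi * real N) * sqrt (p * (1 - p))) * psi p N K s x\<bar>
     \<le> C * real N powr (- (real s + real K + 2) / 2)"
proof -
  define I where "I = (SIGMA i:{..K}. SIGMA \<nu>:{..K - i}. weighted_solutions \<nu>)"
  define c where "c N = (\<lambda>(i, \<nu>, k). exp_coeff s i * edgeworth_coeff p N \<nu> k)" for N
  define j where "j = (\<lambda>(i, \<nu>, k). s + i + (\<nu> + 2 * (\<Sum>m=1..\<nu>. k m)))"
  define a where "a N = sqrt (2 * real N * p * (1 - p))" for N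
  have fin: "finite I" by (auto simp: I_def finite_weighted_solutions)
  have sumI: "(\<Sum>i\<le>K. \<Sum>\<nu>\<le>K - i. \<Sum>k\<in>weighted_solutions \<nu>. f i \<nu> k) = (\<Sum>(i, \<nu>, k)\<in>I. f i \<nu> k)"
    for f :: "nat \<Rightarrow> nat \<Rightarrow> (nat \<Rightarrow> nat) \<Rightarrow> 'a::comm_monoid_add"
    unfolding I_def by (simp add: sum.Sigma finite_weighted_solutions)
  have a: "a N > 0" "step p N = 1 / a N" "(a N)\<^sup>2 / 4 = real N * (p * (1 - p)) / 2" if "0 < N" for N
    using p that by (auto simp: a_def step_def)
  let ?G = "\<lambda>N t x e. of_real (exp (- ((a N)\<^sup>2 * t\<^sup>2 / 4))) * (- (\<i> * complex_of_real (a N * t))) ^ e * exp (- (\<i> * of_real (a N * x * t)))"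
  have T: "of_real (exp (- (real N * (p * (1 - p)) * t\<^sup>2 / 2))) *
         (\<Sum>n<s + Suc K. fps_nth (edgeworth_fps p s (of_real (- (real N * t\<^sup>2)))) n * (\<i> * of_real t) ^ n) *
         exp (- (\<i> * of_real (sqrt (2 * real N * p * (1 - p)) * x * t)))
     = (\<Sum>l\<in>I. of_real (c N l * step p N ^ j l) * ?G N t x (j l))" if N: "0 < N" for N t x
  proof -
    have e: "exp (- (real N * (p * (1 - p)) * t\<^sup>2 / 2)) = exp (- ((a N)\<^sup>2 * t\<^sup>2 / 4))"
    proof -
      have "(a N)\<^sup>2 * t\<^sup>2 / 4 = (a N)\<^sup>2 / 4 * t\<^sup>2" by simp
      also have "\<dots> = real N * (p * (1 - p)) * t\<^sup>2 / 2" unfolding a(3)[OF N] by simp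
      finally show ?thesis by (simp only:)
    qed
    have pw: "(- (\<i> * complex_of_real t)) ^ e = of_real (step p N ^ e) * (- (\<i> * of_real (a N * t))) ^ e" for e
    proof -
      have "- (\<i> * complex_of_real t) = of_real (step p N) * (- (\<i> * of_real (a N * t)))"
        using a[OF N] by simp
      then show ?thesis by (simp only: power_mult_distrib of_real_power)
    qed
    have "(\<Sum>n<s + Suc K. fps_nth (edgeworth_fps p s (of_real (- (real N * t\<^sup>2)))) n * (\<i> * of_real t) ^ n)
      = (\<Sum>l\<in>I. of_real (c N l) * (- (\<i> * of_real t)) ^ j l)"
      unfolding edgeworth_polynomial[OF p] sumI by (rule sum.cong) (auto simp: c_def j_def)
    then show ?thesis
      unfolding e a_def[symmetric] by (simp only: sum_distrib_left sum_distrib_right pw of_real_mult mult_ac)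
  qed
  have intG: "integrable lborel (\<lambda>t. ?G N t x e)" if "0 < N" for N x e
    by (rule integrable_gauss_fourier[OF a(1)[OF that]])
  have intT: "(LINT t|lborel. (\<Sum>l\<in>I. of_real (c N l * step p N ^ j l) * ?G N t x (j l))) / of_real (2 * pi)
     = of_real (exp (- (x\<^sup>2)) / (sqrt (2 * pi * real N) * sqrt (p * (1 - p))) * psi p N K s x)" if N: "0 < N" for N x
  proof -
    let ?g = "\<lambda>e. (deriv ^^ e) (\<lambda>t. exp (- t\<^sup>2)) x"
    have "(LINT t|lborel. (\<Sum>l\<in>I. of_real (c N l * step p N ^ j l) * ?G N t x (j l)))
       = (\<Sum>l\<in>I. of_real (c N l * step p N ^ j l) * gauss_fourier (a N) (j l) x)"
      unfolding gauss_fourier_def by (rule integral_sum_mult_left[OF intG[OF N]])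
    also have "\<dots> = of_real (2 * sqrt pi / a N * (\<Sum>l\<in>I. c N l * (step p N ^ j l * ?g (j l))))"
      unfolding gauss_fourier_eq[OF a(1)[OF N]] sum_distrib_left of_real_sum
      by (rule sum.cong) (simp_all only: of_real_mult[symmetric] mult_ac)
    also have "(\<Sum>l\<in>I. c N l * (step p N ^ j l * ?g (j l))) = exp (- x\<^sup>2) * psi p N K s x"
      unfolding exp_psi[OF p N] sumI by (rule sum.cong) (auto simp: c_def j_def)
    finally have "(LINT t|lborel. (\<Sum>l\<in>I. of_real (c N l * step p N ^ j l) * ?G N t x (j l))) / of_real (2 * pi)
      = of_real (2 * sqrt pi / a N * (exp (- x\<^sup>2) * psi p N K s x) / (2 * pi))"
      by (simp only: of_real_divide)
    also have "2 * sqrt pi / a N * (exp (- x\<^sup>2) * psi p N K s x) / (2 * pi)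
       = (sqrt pi / pi / a N) * (exp (- x\<^sup>2) * psi p N K s x)" by simp
    \<comment> \<open>The normalisation is \<open>2 sqrt \<pi> / a\<close> from the Gaussian
      integral times \<open>1 / (2 \<pi>)\<close> from the Fourier coefficient.\<close>
    also have "sqrt pi / pi / a N = 1 / (sqrt (2 * pi * real N) * sqrt (p * (1 - p)))"
    proof -
      have "sqrt pi / pi = 1 / sqrt pi" by (simp add: field_simps)
      moreover have "sqrt pi * a N = sqrt (2 * pi * real N) * sqrt (p * (1 - p))"
        by (simp add: a_def mult_ac flip: real_sqrt_mult)
      ultimately show ?thesis by simp
    qed
    finally show ?thesis by simp
  qed
  obtain C where C: "0 \<le> C" "\<And>N x. 0 < N \<Longrightarrow> 0 \<le> xhat p N x \<Longrightarrow> xhat p N x + real s \<le> real N \<Longrightarrow>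
     norm (of_real ((fwd_diff ^^ s) (weight p N) (xhat p N x)) -
       (LINT t|lborel. of_real (exp (- (real N * (p * (1 - p)) * t\<^sup>2 / 2))) *
         (\<Sum>n<s + Suc K. fps_nth (edgeworth_fps p s (of_real (- (real N * t\<^sup>2)))) n * (\<i> * of_real t) ^ n) *
         exp (- (\<i> * of_real (sqrt (2 * real N * p * (1 - p)) * x * t)))) / of_real (2 * pi))
      \<le> C * real N powr (- (real (s + Suc K) + 1) / 2)"
  proof (rule fwd_diff_weight_approx[of s "s + Suc K"])
    fix N :: nat and x :: real assume N: "0 < N"
    show "integrable lborel (\<lambda>t. of_real (exp (- (real N * (p * (1 - p)) * t\<^sup>2 / 2))) *
         (\<Sum>n<s + Suc K. fps_nth (edgeworth_fps p s (of_real (- (real N * t\<^sup>2)))) n * (\<i> * of_real t) ^ n) *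
         exp (- (\<i> * of_real (sqrt (2 * real N * p * (1 - p)) * x * t))))"
      unfolding T[OF N] by (intro Bochner_Integration.integrable_sum integrable_mult_right intG N)
  qed (rule that)
  show thesis
  proof (rule that[of C])
    fix N :: nat and x :: real
    assume N: "0 < N" and x: "0 \<le> xhat p N x" "xhat p N x + real s \<le> real N"
    have e: "- (real (s + Suc K) + 1) / 2 = - (real s + real K + 2) / 2" by simp
    show "\<bar>(fwd_diff ^^ s) (weight p N) (xhat p N x) -
       exp (- (x\<^sup>2)) / (sqrt (2 * pi * real N) * sqrt (p * (1 - p))) * psi p N K s x\<bar>
     \<le> C * real N powr (- (real s + real K + 2) / 2)"
      using C(2)[OF N x] unfolding T[OF N] intT[OF N] e by (simp only: of_real_diff[symmetric] norm_of_real)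
  qed (rule C(1))
qed

end

section \<open>Uniformity in \<open>x\<close> and the final estimate\<close>

lemma xhat_eventually_in_range:
  fixes p A :: real
  assumes p: "0 < p" "p < 1" and A: "0 < A"
  shows "\<forall>\<^sub>F N in sequentially. 0 < N \<and> (\<forall>x. \<bar>x\<bar> \<le> A \<longrightarrow> 0 \<le> xhat p N x \<and> xhat p N x + real n \<le> real N)"
proof -
  \<comment> \<open>With \<open>r = sqrt N\<close> the deviation of \<open>xhat\<close> from
    \<open>N p\<close> is at most \<open>r A\<close>. So it suffices that \<open>A \<le> r p\<close>
    and \<open>A + n \<le> r (1 - p)\<close>, each multiplied by \<open>r\<close>; the entry
    \<open>1\<close> ensures \<open>n \<le> r n\<close>.\<close>
  define B where "B = max 1 (max (A / p) ((A + real n) / (1 - p)))"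
  have "\<forall>\<^sub>F N in sequentially. B\<^sup>2 \<le> real N"
    using filterlim_real_sequentially by (simp add: filterlim_at_top)
  then show ?thesis
  proof eventually_elim
    case (elim N)
    have B: "1 \<le> B" "A / p \<le> B" "(A + real n) / (1 - p) \<le> B" by (auto simp: B_def)
    define r where "r = sqrt (real N)"
    have r: "B \<le> r" "r * r = real N"
      using elim real_le_rsqrt by (auto simp: r_def)
    have r1: "1 \<le> r" "A \<le> r * p" "A + real n \<le> r * (1 - p)"
      using B r(1) p by (auto simp: divide_le_eq intro: order.trans[OF _ mult_right_mono[of B r]])
    have "0 \<le> (p - 1 / 2) ^ 2" by simp
    then have "p * (1 - p) \<le> 1 / 4" by (simp add: power2_eq_square algebra_simps)
    then have "sqrt (2 * p * (1 - p)) \<le> sqrt 1" by (intro real_sqrt_le_mono) simp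
    then have q: "sqrt (2 * real N * p * (1 - p)) \<le> r"
      using mult_left_mono[of "sqrt (2 * p * (1 - p))" 1 r] r1 by (simp add: r_def mult_ac flip: real_sqrt_mult)
    have q0: "0 \<le> sqrt (2 * real N * p * (1 - p))" using p by simp
    show ?case
    proof (intro conjI allI impI)
      show "0 < N" using r r1 by (cases N) (auto simp: r_def)
      fix x :: real assume x: "\<bar>x\<bar> \<le> A"
      have "\<bar>sqrt (2 * real N * p * (1 - p)) * x\<bar> \<le> r * A"
        unfolding abs_mult using q q0 x r1 by (intro mult_mono) auto
      then have b: "- (r * A) \<le> sqrt (2 * real N * p * (1 - p)) * x" "sqrt (2 * real N * p * (1 - p)) * x \<le> r * A"
        by (auto simp: abs_le_iff)
      have "r * A \<le> r * (r * p)" using r1 by (intro mult_left_mono) auto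
      then have "r * A \<le> real N * p" using r(2) by (simp flip: mult.assoc)
      then show "0 \<le> xhat p N x" using b unfolding xhat_def by linarith
      have "r * (A + real n) \<le> r * (r * (1 - p))" using r1 by (intro mult_left_mono) auto
      then have "r * A + r * real n \<le> real N - real N * p" using r(2) by (simp add: algebra_simps flip: mult.assoc)
      moreover have "1 * real n \<le> r * real n" using r1 by (intro mult_right_mono) auto
      ultimately show "xhat p N x + real n \<le> real N" using b unfolding xhat_def by linarith
    qed
  qed
qed

lemma ffact_add_bound:
  assumes "0 \<le> y" "y + real s \<le> B"
  shows "\<bar>ffact (y + real s) s\<bar> \<le> B ^ s"
proof -
  have "\<bar>ffact (y + real s) s\<bar> = (\<Prod>i<s. \<bar>y + real s - real i\<bar>)" by (simp add: ffact_def abs_prod)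
  also have "\<dots> \<le> (\<Prod>i<s. B)" using assms by (intro prod_mono) auto
  finally show ?thesis by simp
qed

lemma krawtchouk_term_bound:
  fixes p A :: real and M n k :: nat
  assumes p: "0 < p" "p < 1" and A: "0 < A" and k: "k \<le> n"
  obtains C where "\<forall>\<^sub>F N in sequentially. \<forall>x. \<bar>x\<bar> \<le> A \<longrightarrow>
    \<bar>ffact (xhat p N x + real (n - k)) (n - k) * ((fwd_diff ^^ (n - k)) (weight p N) (xhat p N x) -
      (if k \<le> M then exp (- (x\<^sup>2)) / (sqrt (2 * pi * real N) * sqrt (p * (1 - p))) * psi p N M (n - k) x else 0))\<bar>
    \<le> C * real N powr ((real n - real M - 2) / 2)"
proof -
  define s where "s = n - k"
  \<comment> \<open>The total exponent \<open>s + e\<close> attains \<open>(n - M - 2) / 2\<close>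
    at \<open>k = 0\<close> in the first case and at \<open>k = M + 1\<close> in the second.\<close>
  define e where "e = (if k \<le> M then - (real s + real M + 2) / 2 else - (real s + 1) / 2)"
  have e: "real s + e \<le> (real n - real M - 2) / 2"
    using k by (auto simp: e_def s_def of_nat_diff field_simps)
  have "\<exists>C\<ge>0. \<forall>N x. 0 < N \<longrightarrow> 0 \<le> xhat p N x \<longrightarrow> xhat p N x + real s \<le> real N \<longrightarrow>
     \<bar>(fwd_diff ^^ s) (weight p N) (xhat p N x) -
       (if k \<le> M then exp (- (x\<^sup>2)) / (sqrt (2 * pi * real N) * sqrt (p * (1 - p))) * psi p N M s x else 0)\<bar>
     \<le> C * real N powr e"
  proof (cases "k \<le> M")
    case True
    obtain C where C: "0 \<le> C" "\<And>N x. 0 < N \<Longrightarrow> 0 \<le> xhat p N x \<Longrightarrow> xhat p N x + real s \<le> real N \<Longrightarrow>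
     \<bar>(fwd_diff ^^ s) (weight p N) (xhat p N x) -
       exp (- (x\<^sup>2)) / (sqrt (2 * pi * real N) * sqrt (p * (1 - p))) * psi p N M s x\<bar>
     \<le> C * real N powr (- (real s + real M + 2) / 2)"
      by (rule fwd_diff_weight_psi[OF p, of s M]) (rule that)
    show ?thesis unfolding e_def using True C by (intro exI[of _ C]) simp
  next
    case False
    obtain C where C: "0 \<le> C" "\<And>N x. 0 < N \<Longrightarrow> 0 \<le> xhat p N x \<Longrightarrow> xhat p N x + real s \<le> real N \<Longrightarrow>
     \<bar>(fwd_diff ^^ s) (weight p N) (xhat p N x)\<bar> \<le> C * real N powr (- (real s + 1) / 2)"
      by (rule fwd_diff_weight_bound[OF p, of s]) (rule that)
    show ?thesis unfolding e_def using False C by (intro exI[of _ C]) simp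
  qed
  then obtain C where C: "0 \<le> C" "\<And>N x. 0 < N \<Longrightarrow> 0 \<le> xhat p N x \<Longrightarrow> xhat p N x + real s \<le> real N \<Longrightarrow>
     \<bar>(fwd_diff ^^ s) (weight p N) (xhat p N x) -
       (if k \<le> M then exp (- (x\<^sup>2)) / (sqrt (2 * pi * real N) * sqrt (p * (1 - p))) * psi p N M s x else 0)\<bar>
     \<le> C * real N powr e" by blast
  show thesis
  proof (rule that[of C])
    show "\<forall>\<^sub>F N in sequentially. \<forall>x. \<bar>x\<bar> \<le> A \<longrightarrow>
    \<bar>ffact (xhat p N x + real (n - k)) (n - k) * ((fwd_diff ^^ (n - k)) (weight p N) (xhat p N x) -
      (if k \<le> M then exp (- (x\<^sup>2)) / (sqrt (2 * pi * real N) * sqrt (p * (1 - p))) * psi p N M (n - k) x else 0))\<bar>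
    \<le> C * real N powr ((real n - real M - 2) / 2)"
      using xhat_eventually_in_range[OF p A, of s]
    proof eventually_elim
      case (elim N)
      then have N: "0 < N" by simp
      show ?case
      proof (intro allI impI)
        fix x :: real assume "\<bar>x\<bar> \<le> A"
        then have x: "0 \<le> xhat p N x" "xhat p N x + real s \<le> real N" using elim by auto
        have "real N ^ s * (C * real N powr e) = C * real N powr (real s + e)"
          using N by (simp add: powr_add powr_realpow)
        also have "\<dots> \<le> C * real N powr ((real n - real M - 2) / 2)"
          using N C(1) e by (intro mult_left_mono powr_mono) auto
        finally show "\<bar>ffact (xhat p N x + real (n - k)) (n - k) * ((fwd_diff ^^ (n - k)) (weight p N) (xhat p N x) -
          (if k \<le> M then exp (- (x\<^sup>2)) / (sqrt (2 * pi * real N) * sqrt (p * (1 - p))) * psi p N M (n - k) x else 0))\<bar>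
          \<le> C * real N powr ((real n - real M - 2) / 2)"
          unfolding abs_mult s_def[symmetric]
          by (intro order.trans[OF mult_mono[OF ffact_add_bound[OF x] C(2)[OF N x]]]) auto
      qed
    qed
  qed
qed

theorem theorem2:
  fixes p q \<sigma> A :: real and M n :: nat
  assumes "0 < p" and "p < 1" and "q = 1 - p" and "\<sigma> = sqrt (p * q)" and "0 < A"
  shows "\<exists>C::real. \<forall>\<^sub>F N in sequentially. \<forall>x::real. \<bar>x\<bar> \<le> A \<longrightarrow>
    \<bar>weight p N (xhat p N x) * krawtchouk p N n (xhat p N x) -
      exp (- (x\<^sup>2)) / (sqrt (2 * pi * real N) * \<sigma>) * ((- q) ^ n / fact n) *
      (\<Sum>k\<le>M. if k \<le> n
         then real (n choose k) * ffact (real n) k *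
              ffact (xhat p N x + real (n - k)) (n - k) * psi p N M (n - k) x
         else 0)\<bar>
    \<le> C * real N powr ((real n - real M - 2) / 2)"
proof -
  note p = \<open>0 < p\<close> \<open>p < 1\<close>
  let ?G = "\<lambda>N x. exp (- (x\<^sup>2)) / (sqrt (2 * pi * real N) * \<sigma>)"
  let ?F = "\<lambda>N x k. ffact (xhat p N x + real (n - k)) (n - k)"
  let ?t = "\<lambda>N x k. ?F N x k * ((fwd_diff ^^ (n - k)) (weight p N) (xhat p N x) -
      (if k \<le> M then ?G N x * psi p N M (n - k) x else 0))"
  let ?e = "(real n - real M - 2) / 2"
  let ?b = "\<lambda>k. real (n choose k) * ffact (real n) k"
  have "\<forall>k\<in>{..n}. \<exists>C. \<forall>\<^sub>F N in sequentially. \<forall>x. \<bar>x\<bar> \<le> A \<longrightarrow> \<bar>?t N x k\<bar> \<le> C * real N powr ?e"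
  proof
    fix k assume "k \<in> {..n}"
    then have "k \<le> n" by simp
    then show "\<exists>C. \<forall>\<^sub>F N in sequentially. \<forall>x. \<bar>x\<bar> \<le> A \<longrightarrow> \<bar>?t N x k\<bar> \<le> C * real N powr ?e"
      unfolding \<open>\<sigma> = _\<close> \<open>q = _\<close> by (rule krawtchouk_term_bound[OF p \<open>0 < A\<close>, of k n M]) (rule exI)
  qed
  \<comment> \<open>There are finitely many \<open>k\<close>, so the eventual bounds hold
    simultaneously and their constants can be summed.\<close>
  from bchoice[OF this] obtain C where C: "\<forall>k\<in>{..n}. \<forall>\<^sub>F N in sequentially. \<forall>x. \<bar>x\<bar> \<le> A \<longrightarrow> \<bar>?t N x k\<bar> \<le> C k * real N powr ?e" ..
  then have ev: "\<forall>\<^sub>F N in sequentially. \<forall>k\<in>{..n}. \<forall>x. \<bar>x\<bar> \<le> A \<longrightarrow> \<bar>?t N x k\<bar> \<le> C k * real N powr ?e"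
    by (intro eventually_ball_finite finite_atMost)
  define D where "D = \<bar>(- q) ^ n / fact n\<bar> * (\<Sum>k\<le>n. \<bar>?b k\<bar> * C k)"
  show ?thesis
  proof (rule exI[of _ D])
    show "\<forall>\<^sub>F N in sequentially. \<forall>x::real. \<bar>x\<bar> \<le> A \<longrightarrow>
      \<bar>weight p N (xhat p N x) * krawtchouk p N n (xhat p N x) -
      exp (- (x\<^sup>2)) / (sqrt (2 * pi * real N) * \<sigma>) * ((- q) ^ n / fact n) *
      (\<Sum>k\<le>M. if k \<le> n
         then real (n choose k) * ffact (real n) k *
              ffact (xhat p N x + real (n - k)) (n - k) * psi p N M (n - k) x
         else 0)\<bar> \<le> D * real N powr ?e"
      using ev xhat_eventually_in_range[OF p \<open>0 < A\<close>, of n]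
    proof eventually_elim
      case (elim N)
      show ?case
      proof (intro allI impI)
        fix x :: real assume x: "\<bar>x\<bar> \<le> A"
        let ?y = "xhat p N x"
        let ?\<psi> = "\<lambda>k. psi p N M (n - k) x"
        have "0 \<le> ?y" "?y + real n \<le> real N" using elim x by auto
        then have K: "weight p N ?y * krawtchouk p N n ?y = (- q) ^ n / fact n *
          (\<Sum>k\<le>n. ?b k * ?F N x k * (fwd_diff ^^ (n - k)) (weight p N) ?y)"
          unfolding \<open>q = 1 - p\<close> by (rule krawtchouk_expansion_fwd_diff[OF p])
        \<comment> \<open>Brings the sum up to \<open>M\<close> and the Leibniz sum up to
          \<open>n\<close> to the same range; for \<open>M < k \<le> n\<close> nothing is subtracted
          from the Leibniz term.\<close>
        have S: "(\<Sum>k\<le>M. if k \<le> n then ?b k * ?F N x k * ?\<psi> k else 0)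
          = (\<Sum>k\<le>n. if k \<le> M then ?b k * ?F N x k * ?\<psi> k else 0)"
          by (simp add: sum.If_cases Int_def conj_commute)
        have diff: "weight p N ?y * krawtchouk p N n ?y -
            ?G N x * ((- q) ^ n / fact n) * (\<Sum>k\<le>M. if k \<le> n then ?b k * ?F N x k * ?\<psi> k else 0)
          = (- q) ^ n / fact n * (\<Sum>k\<le>n. ?b k * ?t N x k)"
          unfolding K S sum_distrib_left sum_subtractf[symmetric]
          by (intro sum.cong refl) (auto simp: right_diff_distrib mult_ac)
        have bound: "\<bar>(- q) ^ n / fact n * (\<Sum>k\<le>n. ?b k * ?t N x k)\<bar> \<le> \<bar>(- q) ^ n / fact n\<bar> * (\<Sum>k\<le>n. \<bar>?b k\<bar> * (C k * real N powr ?e))"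
          unfolding abs_mult[of "(- q) ^ n / fact n"]
        proof (intro mult_left_mono order.trans[OF sum_abs] sum_mono)
          fix k assume "k \<in> {..n}"
          then have "\<bar>?t N x k\<bar> \<le> C k * real N powr ?e" using elim(1) x by blast
          then show "\<bar>?b k * ?t N x k\<bar> \<le> \<bar>?b k\<bar> * (C k * real N powr ?e)"
            unfolding abs_mult[of "?b k"] by (intro mult_left_mono) auto
        qed auto
        have D: "\<bar>(- q) ^ n / fact n\<bar> * (\<Sum>k\<le>n. \<bar>?b k\<bar> * (C k * real N powr ?e)) = D * real N powr ?e"
          unfolding D_def by (simp only: sum_distrib_right mult.assoc)
        show "\<bar>weight p N ?y * krawtchouk p N n ?y -
            ?G N x * ((- q) ^ n / fact n) * (\<Sum>k\<le>M. if k \<le> n then ?b k * ?F N x k * ?\<psi> k else 0)\<bar> \<le> D * real N powr ?e"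
          using bound unfolding diff D .
      qed
    qed
  qed
qed

end
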